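(* $|\mathbb{I}^*|=\{2^{n/12}:n\in\mathbb{Z}\}$.
   Context: Setting: a set $\mathbb{S}$ (of "sounds"), a binary relation $*$ on $\mathbb{S}$ ($x*y$: $x$ is lower-pitched than $y$), a relation $\cong$ on intervals, a binary relation $\simeq$ on $\mathbb{S}$ ("equitonal") and a set $\mathbb{I}^*$ of "harmonic" intervals, satisfying the axioms below. (The paper's further axioms on loudness and colour concern other notions not occurring in the claim.) Pitch. Write $x\sim y$ iff neither $x*y$ nor $y*x$. (1) $\neg(x*x)$ for all $x$. (2) $*$ is transitive. (3) There are $x,y$ with $x*y$ or $y*x$. (4) If $x*y$, then no $z$ satisfies both $x\sim z$ and $y\sim z$. (5) For every $x$ there are $a,b$ with $a*x$ and $x*b$; and if $x*y$ there is $a$ with $x*a$ and $a*y$. Then $\sim$ is an equivalence relation; $\tilde x$ is the class of $x$. Intervals. $[a,b]:=(\tilde a,\tilde b)$, $[a,b]^{-1}:=[b,a]$, $\mathbb{I}:=(\mathbb{S}/\sim)\times(\mathbb{S}/\sim)$, and $\cong$ is a binary relation on $\mathbb{I}$. (6) $\cong$ is reflexive. (7) $\cong$ is transitive. (8) For all $x,y,a$ there is $b$ with $[x,y]\cong[a,b]$, and any $b'$ with $[x,y]\cong[a,b']$ satisfies $b\sim b'$. (9) If $a*b$: $[a,b]\cong[c,d]$ implies $c*d$; and $[a,b]\cong[c,d]$ iff $[b,a]\cong[d,c]$. (10) If $a*b$ and $b*c$: $[a,b]\cong[a',b']$ and $[b,c]\cong[b',c']$ imply $[a,c]\cong[a',c']$;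 and $[a,b]\cong[a',b']^{-1}$ and $[b,c]\cong[b',c']^{-1}$ imply $[a,c]\cong[a',c']^{-1}$. (11) (Dedekind) If $\mathbb{S}$ is partitioned into two nonempty sets $P,Q$ such that no sound of $Q$ is lower-pitched than a sound of $P$, there is $\theta\in\mathbb{S}$ such that every $s*\theta$ lies in $P$ and every $s$ with $\theta*s$ lies in $Q$. Tonality. (15) $x\sim y$ implies $x\simeq y$; and $x\simeq z$, $y\simeq z$ imply $x\simeq y$. $\hat s$ is the $\simeq$-class of $s$. A sound minimal with respect to $*$ in $\{x: x\simeq s,\ s*x\}$, when it exists, is denoted $s^*$ (unique up to $\sim$), and $[s,s^*]$ is called an octave interval. An octave interval exists. (16) Every interval congruent to an octave interval is an octave interval. Measure. Under these axioms all octave intervals are congruent and there is a unique $|\cdot|:\mathbb{I}\to\mathbb{R}^+$ such that octave intervals have measure $2$, $|[a,b]|>1$ iff $a*b$, $|[a,b]|=1$ iff $a\sim b$, $|[a,b]|<1$ iff $b*a$, $|[a,b]|=|[c,d]|$ iff $[a,b]\cong[c,d]$, and $|[a,c]|=|[a,b]|\cdot|[b,c]|$; it is onto. Harmony. $|\mathbb{I}^*|=\{|I|:I\in\mathbb{I}^*\}$. (17) If $a*b$, $[a,b]\cong[c,d]$ and $[a,b]$ is harmonic, then $[c,d]$ is harmonic; and if $[a,b]$ is harmonic with $a\not\sim b$, then $[b,a]$ is harmonic. (18) If $r,r'\in|\mathbb{I}^*|$, $r>1$ and $r'\neq1$, then $rr'\in|\mathbb{I}^*|$. (19) There is $\alpha>1$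 such that no $\beta\in|\mathbb{I}^*|$ satisfies $1<\beta<\alpha$. Put $\varepsilon:=\inf\{r\in|\mathbb{I}^*|:r>1\}$. A scale is a triple $(\hat s,(r_i)_{i=1}^m,(r'_i)_{i=1}^n)$ with $s\in\mathbb{S}$, $r_i\in|\mathbb{I}^*|$, $r_i>1$, $r'_i\in|\mathbb{I}^*|$, $r'_i<1$, $\prod r_i=2$, $\prod r'_i=1/2$; its tonic is $\hat s$. It is heptatonic if $m=n=7$, and compatible if $m=n$ and $r'_i=r_{n-i+1}^{-1}$ for all $i$. Its ascendent (descendent) mode is $\{r_i\}$ ($\{r'_i\}$); a mode is maximally even if it is contained in $\{\varepsilon^k,\varepsilon^{k+1}\}$ for some integer $k$. Let $s_0=s'_0=s$, $|[s_{i-1},s_i]|=r_i$, $|[s'_{j-1},s'_j]|=r'_j$; the ascendent components set is $\{\hat s_i:0\le i\le m\}$. The ascendent (descendent) module has the sensible if $r_m=\varepsilon$ ($r_n'^{-1}=\varepsilon$). A tetrachord is a triple $(r_{k-1},r_k,r_{k+1})$ with $1<k<m$, with components $\hat s_{k-2},\hat s_{k-1},\hat s_k,\hat s_{k+1}$, or a triple $(r'_{l-1},r'_l,r'_{l+1})$ with $1<l<n$, with components $\hat s'_{l-2},\dots,\hat s'_{l+1}$; two tetrachords are disjoint if their sets of components have no common element except possibly $\hat s$. A triad is $(x,y,z)$ with $x*y$, $y*z$ and $[x,y],[y,z]$ harmonic; it is major if $|[x,y]|=\varepsilon\,|[y,z]|$ and $[x,z]$ is harmonic of measure $\varepsilon\cdot2^{1/2}$.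 A triad $(x,y,z)$ is scale-based on the tonic of a compatible scale if $\hat s,\hat u,\hat v$ all lie in the ascendent components set, where $|[s,u]|=|[x,y]|$ and $|[u,v]|=|[y,z]|$. (20) (Major Scale Axiom) There exists a heptatonic compatible scale with maximally even mode, whose ascendent module has the sensible and whose descendent module does not, having two disjoint and equal tetrachords, and such that a major triad is scale-based on its tonic. *)

theory Defs
  imports Complex_Main "HOL-Library.FuncSet"
begin

text \<open>The set of sounds is the (universe of the) type \<open>'a\<close>; \<open>x \<prec> y\<close> means that \<open>x\<close> is
  lower-pitched than \<open>y\<close>. An interval \<open>[a,b]\<close> is a pair of pitch classes.\<close>

type_synonym 'a interval = "'a set \<times> 'a set"

locale pitch_relation =
  fixes lower :: "'a \<Rightarrow> 'a \<Rightarrow> bool"  (infix "\<prec>" 50)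
begin

definition same_pitch :: "'a \<Rightarrow> 'a \<Rightarrow> bool"  (infix "\<sim>" 50) where
  "x \<sim> y \<longleftrightarrow> \<not> x \<prec> y \<and> \<not> y \<prec> x"

definition pitch_class :: "'a \<Rightarrow> 'a set" where
  "pitch_class x = {(x, y). x \<sim> y} `` {x}"

definition ivl :: "'a \<Rightarrow> 'a \<Rightarrow> 'a interval" where
  "ivl a b = (pitch_class a, pitch_class b)"

definition intervals :: "'a interval set" where
  "intervals = (UNIV // {(x, y). x \<sim> y}) \<times> (UNIV // {(x, y). x \<sim> y})"

end

locale pitch = pitch_relation +
  assumes lower_irrefl: "\<not> x \<prec> x"
    and lower_trans: "x \<prec> y \<Longrightarrow> y \<prec> z \<Longrightarrow> x \<prec> z"
    and lower_nontrivial: "\<exists>x y. x \<prec> y \<or> y \<prec> x"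
    and lower_separates: "x \<prec> y \<Longrightarrow> \<not> (\<exists>z. x \<sim> z \<and> y \<sim> z)"
    and lower_unbounded: "\<exists>a b. a \<prec> x \<and> x \<prec> b"
    and lower_dense: "x \<prec> y \<Longrightarrow> \<exists>a. x \<prec> a \<and> a \<prec> y"

text \<open>The inverse of an interval is \<^const>\<open>prod.swap\<close>.\<close>

locale congruent_intervals = pitch +
  fixes cong :: "'a interval \<Rightarrow> 'a interval \<Rightarrow> bool"  (infix "\<cong>" 50)
  assumes cong_on_intervals: "I \<cong> J \<Longrightarrow> I \<in> intervals \<and> J \<in> intervals"
    and cong_refl: "I \<in> intervals \<Longrightarrow> I \<cong> I"
    and cong_trans: "I \<cong> J \<Longrightarrow> J \<cong> K \<Longrightarrow> I \<cong> K"
    and cong_transfer: "\<exists>b. ivl x y \<cong> ivl a b \<and> (\<forall>b'. ivl x y \<cong> ivl a b' \<longrightarrow> b \<sim> b')"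
    and cong_lower: "a \<prec> b \<Longrightarrow> ivl a b \<cong> ivl c d \<Longrightarrow> c \<prec> d"
    and cong_reverse: "a \<prec> b \<Longrightarrow> ivl a b \<cong> ivl c d \<longleftrightarrow> ivl b a \<cong> ivl d c"
    and cong_compose:
      "a \<prec> b \<Longrightarrow> b \<prec> c \<Longrightarrow> ivl a b \<cong> ivl a' b' \<Longrightarrow> ivl b c \<cong> ivl b' c' \<Longrightarrow> ivl a c \<cong> ivl a' c'"
    and cong_compose_inverse:
      "a \<prec> b \<Longrightarrow> b \<prec> c \<Longrightarrow> ivl a b \<cong> prod.swap (ivl a' b') \<Longrightarrow> ivl b c \<cong> prod.swap (ivl b' c')
        \<Longrightarrow> ivl a c \<cong> prod.swap (ivl a' c')"
    and dedekind:
      "P \<noteq> {} \<Longrightarrow> Q \<noteq> {} \<Longrightarrow> P \<union> Q = UNIV \<Longrightarrow> P \<inter> Q = {} \<Longrightarrow> (\<And>p q. p \<in> P \<Longrightarrow> q \<in> Q \<Longrightarrow> \<not> q \<prec> p)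
        \<Longrightarrow> \<exists>\<theta>. (\<forall>s. s \<prec> \<theta> \<longrightarrow> s \<in> P) \<and> (\<forall>s. \<theta> \<prec> s \<longrightarrow> s \<in> Q)"

locale equitonal_relation = congruent_intervals +
  fixes equitonal :: "'a \<Rightarrow> 'a \<Rightarrow> bool"  (infix "\<simeq>" 50)
begin

definition tone :: "'a \<Rightarrow> 'a set" where
  "tone s = {(x, y). x \<simeq> y} `` {s}"

text \<open>The sound \<open>s\<^sup>*\<close> need not exist and is only unique up to \<open>\<sim>\<close>, so it is rendered as a
  relation: \<open>is_octave_of s t\<close> says that \<open>t\<close> is a possible \<open>s\<^sup>*\<close>.\<close>

definition is_octave_of :: "'a \<Rightarrow> 'a \<Rightarrow> bool" where
  "is_octave_of s t \<longleftrightarrow>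
     t \<in> {x. x \<simeq> s \<and> s \<prec> x} \<and> \<not> (\<exists>x \<in> {x. x \<simeq> s \<and> s \<prec> x}. x \<prec> t)"

definition octave_interval :: "'a interval \<Rightarrow> bool" where
  "octave_interval I \<longleftrightarrow> (\<exists>s t. is_octave_of s t \<and> I = ivl s t)"

end

locale tonality = equitonal_relation +
  assumes equitonal_if_same_pitch: "x \<sim> y \<Longrightarrow> x \<simeq> y"
    and equitonal_common: "x \<simeq> z \<Longrightarrow> y \<simeq> z \<Longrightarrow> x \<simeq> y"
    and octave_exists: "\<exists>I. octave_interval I"
    and octave_cong: "octave_interval I \<Longrightarrow> J \<cong> I \<Longrightarrow> octave_interval J"
begin

definition is_measure :: "('a interval \<Rightarrow> real) \<Rightarrow> bool" where
  "is_measure \<mu> \<longleftrightarrow>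
     (\<forall>I. octave_interval I \<longrightarrow> \<mu> I = 2) \<and>
     (\<forall>a b. \<mu> (ivl a b) > 1 \<longleftrightarrow> a \<prec> b) \<and>
     (\<forall>a b. \<mu> (ivl a b) = 1 \<longleftrightarrow> a \<sim> b) \<and>
     (\<forall>a b. \<mu> (ivl a b) < 1 \<longleftrightarrow> b \<prec> a) \<and>
     (\<forall>a b c d. \<mu> (ivl a b) = \<mu> (ivl c d) \<longleftrightarrow> ivl a b \<cong> ivl c d) \<and>
     (\<forall>a b c. \<mu> (ivl a c) = \<mu> (ivl a b) * \<mu> (ivl b c))"

text \<open>Uniqueness is as a function on the set of intervals, hence the extensional function space.\<close>

definition measure :: "'a interval \<Rightarrow> real"  ("\<bar>_\<bar>\<^sub>I") where
  "measure = (THE \<mu>. \<mu> \<in> intervals \<rightarrow>\<^sub>E {0<..} \<and> is_measure \<mu>)"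

end

locale harmonic_intervals = tonality +
  fixes harmonic :: "'a interval set"
begin

definition harmonic_measures :: "real set" where
  "harmonic_measures = measure ` harmonic"

definition eps :: real  ("\<epsilon>") where
  "\<epsilon> = Inf {r \<in> harmonic_measures. r > 1}"

text \<open>A scale is given by its tonic \<open>T\<close> (a tone, that is, a class of \<open>\<simeq>\<close>) and by two lists
  \<open>rs\<close>, \<open>rs'\<close>. Lists are indexed from 0, so that \<open>r\<^sub>i\<close> is \<open>rs ! (i - 1)\<close>.\<close>

definition scale :: "'a set \<Rightarrow> real list \<Rightarrow> real list \<Rightarrow> bool" where
  "scale T rs rs' \<longleftrightarrow>
     T \<in> range tone \<and>
     (\<forall>r \<in> set rs. r \<in> harmonic_measures \<and> r > 1) \<and>
     (\<forall>r \<in> set rs'. r \<in> harmonic_measures \<and> r < 1) \<and>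
     prod_list rs = 2 \<and> prod_list rs' = 1 / 2"

definition heptatonic :: "real list \<Rightarrow> real list \<Rightarrow> bool" where
  "heptatonic rs rs' \<longleftrightarrow> length rs = 7 \<and> length rs' = 7"

definition compatible :: "real list \<Rightarrow> real list \<Rightarrow> bool" where
  "compatible rs rs' \<longleftrightarrow>
     length rs = length rs' \<and>
     (\<forall>i < length rs'. rs' ! i = inverse (rs ! (length rs' - Suc i)))"

text \<open>The mode of a module \<open>rs\<close> is \<open>set rs\<close>.\<close>

definition maximally_even :: "real set \<Rightarrow> bool" where
  "maximally_even M \<longleftrightarrow> (\<exists>k :: int. M \<subseteq> {\<epsilon> powi k, \<epsilon> powi (k + 1)})"

definition ascendent_sensible :: "real list \<Rightarrow> bool" where
  "ascendent_sensible rs \<longleftrightarrow> last rs = \<epsilon>"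

definition descendent_sensible :: "real list \<Rightarrow> bool" where
  "descendent_sensible rs' \<longleftrightarrow> inverse (last rs') = \<epsilon>"

text \<open>\<open>steps rs \<sigma>\<close>: the sounds \<open>\<sigma> 0, \<dots>, \<sigma> (length rs)\<close> are successively spaced by the measures
  in \<open>rs\<close>. \<open>components T rs J\<close> is the set of the tones of \<open>\<sigma> j\<close>, \<open>j \<in> J\<close>, for a sequence starting
  in the tonic; these tones do not depend on the choice of \<open>\<sigma>\<close>, over which the union is taken.\<close>

definition steps :: "real list \<Rightarrow> (nat \<Rightarrow> 'a) \<Rightarrow> bool" where
  "steps rs \<sigma> \<longleftrightarrow> (\<forall>i < length rs. \<bar>ivl (\<sigma> i) (\<sigma> (Suc i))\<bar>\<^sub>I = rs ! i)"

definition components :: "'a set \<Rightarrow> real list \<Rightarrow> nat set \<Rightarrow> 'a set set" where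
  "components T rs J = {tone (\<sigma> j) | \<sigma> j. \<sigma> 0 \<in> T \<and> steps rs \<sigma> \<and> j \<in> J}"

definition components_set :: "'a set \<Rightarrow> real list \<Rightarrow> 'a set set" where
  "components_set T rs = components T rs {0..length rs}"

text \<open>The tetrachords of one module, each paired with its set of components. The index \<open>k\<close> here
  is that of the first component: the middle entry \<open>r\<^sub>k\<^sub>+\<^sub>2\<close> of the triple is \<open>rs ! (k + 1)\<close>.\<close>

definition module_tetrachords :: "'a set \<Rightarrow> real list \<Rightarrow> ((real \<times> real \<times> real) \<times> 'a set set) set" where
  "module_tetrachords T rs =
     {((rs ! k, rs ! (k + 1), rs ! (k + 2)), components T rs {k..k + 3}) | k. k + 2 < length rs}"

definition tetrachords ::
    "'a set \<Rightarrow> real list \<Rightarrow> real list \<Rightarrow> ((real \<times> real \<times> real) \<times> 'a set set) set" where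
  "tetrachords T rs rs' = module_tetrachords T rs \<union> module_tetrachords T rs'"

definition has_disjoint_equal_tetrachords :: "'a set \<Rightarrow> real list \<Rightarrow> real list \<Rightarrow> bool" where
  "has_disjoint_equal_tetrachords T rs rs' \<longleftrightarrow>
     (\<exists>t C t' C'. (t, C) \<in> tetrachords T rs rs' \<and> (t', C') \<in> tetrachords T rs rs' \<and>
        C \<inter> C' \<subseteq> {T} \<and> t = t')"

definition triad :: "'a \<Rightarrow> 'a \<Rightarrow> 'a \<Rightarrow> bool" where
  "triad x y z \<longleftrightarrow> x \<prec> y \<and> y \<prec> z \<and> ivl x y \<in> harmonic \<and> ivl y z \<in> harmonic"

definition major_triad :: "'a \<Rightarrow> 'a \<Rightarrow> 'a \<Rightarrow> bool" where
  "major_triad x y z \<longleftrightarrow>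
     triad x y z \<and> \<bar>ivl x y\<bar>\<^sub>I = \<epsilon> * \<bar>ivl y z\<bar>\<^sub>I \<and>
     ivl x z \<in> harmonic \<and> \<bar>ivl x z\<bar>\<^sub>I = \<epsilon> * 2 powr (1 / 2)"

definition scale_based :: "'a \<Rightarrow> 'a \<Rightarrow> 'a \<Rightarrow> 'a set \<Rightarrow> real list \<Rightarrow> bool" where
  "scale_based x y z T rs \<longleftrightarrow>
     (\<exists>s u v. s \<in> T \<and> \<bar>ivl s u\<bar>\<^sub>I = \<bar>ivl x y\<bar>\<^sub>I \<and> \<bar>ivl u v\<bar>\<^sub>I = \<bar>ivl y z\<bar>\<^sub>I \<and>
        {tone s, tone u, tone v} \<subseteq> components_set T rs)"

end

locale major_scale_harmony = harmonic_intervals +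
  assumes harmonic_subset: "harmonic \<subseteq> intervals"
    and harmonic_cong:
      "a \<prec> b \<Longrightarrow> ivl a b \<cong> ivl c d \<Longrightarrow> ivl a b \<in> harmonic \<Longrightarrow> ivl c d \<in> harmonic"
    and harmonic_inverse: "ivl a b \<in> harmonic \<Longrightarrow> \<not> a \<sim> b \<Longrightarrow> ivl b a \<in> harmonic"
    and harmonic_mult:
      "r \<in> harmonic_measures \<Longrightarrow> r' \<in> harmonic_measures \<Longrightarrow> r > 1 \<Longrightarrow> r' \<noteq> 1
        \<Longrightarrow> r * r' \<in> harmonic_measures"
    and harmonic_gap: "\<exists>\<alpha>>1. \<not> (\<exists>\<beta> \<in> harmonic_measures. 1 < \<beta> \<and> \<beta> < \<alpha>)"
    and major_scale:
      "\<exists>T rs rs'. scale T rs rs' \<and> heptatonic rs rs' \<and> compatible rs rs' \<and>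
         maximally_even (set rs) \<and> ascendent_sensible rs \<and> \<not> descendent_sensible rs' \<and>
         has_disjoint_equal_tetrachords T rs rs' \<and>
         (\<exists>x y z. major_triad x y z \<and> scale_based x y z T rs)"

end

theory Submission
  imports Defs "HOL-Algebra.Group"
begin

text \<open>
  Why the harmonic measures are exactly the powers of \<open>2\<^bsup>1/12\<^esup>\<close>.

  The measure is specified by a definite description, so first there must be exactly one. Congruence
  classes of intervals are added by laying intervals end to end. This makes them an abelian group,
  whose positive elements are the classes of ascending intervals; the continuity axiom makes the
  group Archimedean. By Hoelder's theorem such a group with a chosen positive unit has
  exactly one order-preserving additive map into the reals that sends the unit to 1
  (\<open>additive_exists\<close>, \<open>additive_unique\<close>). With the class of the octave as unit, the measure is 2 to
  the power of that map.

  The harmonic measures then form a multiplicative group of positive reals with a gap above 1. Such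
  a group is cyclic and its generator is its least element above 1, here \<open>\<epsilon>\<close>
  (\<open>discrete_multiplicative_group\<close>). It remains to show \<open>\<epsilon>\<^bsup>12\<^esup> = 2\<close>, and for this the Major Scale
  Axiom is read as a puzzle about seven steps:

  \<^item> The last step is \<open>\<epsilon>\<close>, the first is not, and all steps lie in \<open>{\<epsilon>\<^bsup>k\<^esup>, \<epsilon>\<^bsup>k+1\<^esup>}\<close>: so each step is
    \<open>\<epsilon>\<close> or \<open>\<epsilon>\<^sup>2\<close>, and the first is \<open>\<epsilon>\<^sup>2\<close> (\<open>major_scale_steps\<close>).
  \<^item> The components strictly inside the octave are not the tonic, so two tetrachords that share one of
    them are not disjoint. Hence two disjoint tetrachords of one module are its first three and its last
    three steps, and their equality gives the pattern \<open>\<epsilon>\<^sup>2, \<epsilon>\<^sup>a, \<epsilon>, \<epsilon>\<^sup>b, \<epsilon>\<^sup>2, \<epsilon>\<^sup>a, \<epsilon>\<close> with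
    \<open>a, b \<in> {1, 2}\<close> (\<open>major_scale_pattern\<close>). So \<open>2 = \<epsilon>\<^bsup>N\<^esup>\<close> with \<open>N = 6 + 2a + b \<in> {9, 10, 11, 12}\<close>.
  \<^item> The upper interval of a major triad is harmonic and has measure \<open>2\<^bsup>1/4\<^esup>\<close>
    (\<open>major_triad_fourth_root\<close>), so 4 divides \<open>N\<close>.

  Together \<open>N = 12\<close>.
\<close>

(* The locales write congruence of intervals with the symbol of group isomorphism. *)
no_notation is_iso (infixr "\<cong>" 60)

section \<open>Archimedean ordered abelian groups embed uniquely into the reals\<close>

text \<open>The order is given by the cone of its positive elements: \<open>x\<close> is below \<open>y\<close> if \<open>y \<otimes> inv x\<close>
  is in the cone.\<close>

locale archimedean_ordered_group = comm_group G for G (structure) +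
  fixes Pos
  assumes Pos_carrier: "x \<in> Pos \<Longrightarrow> x \<in> carrier G"
    and Pos_mult: "x \<in> Pos \<Longrightarrow> y \<in> Pos \<Longrightarrow> x \<otimes> y \<in> Pos"
    and one_not_Pos: "\<one> \<notin> Pos"
    and Pos_cases: "x \<in> carrier G \<Longrightarrow> x \<in> Pos \<or> x = \<one> \<or> inv x \<in> Pos"
    and archimedean: "x \<in> Pos \<Longrightarrow> y \<in> carrier G \<Longrightarrow> \<exists>n::nat. x [^] n \<otimes> inv y \<in> Pos"
begin

lemma Pos_inv: "x \<in> Pos \<Longrightarrow> inv x \<notin> Pos"
  using Pos_mult[of x "inv x"] Pos_carrier[of x] one_not_Pos by auto

lemma Pos_int_pow:
  assumes "x \<in> Pos" and "(n::int) > 0" shows "x [^] n \<in> Pos"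
proof -
  have "x [^] (Suc k) \<in> Pos" for k :: nat
    using assms(1) Pos_carrier by (induction k) (auto intro: Pos_mult)
  from this[of "nat n - 1"] assms(2) have "x [^] nat n \<in> Pos"
    by (simp del: nat_pow_Suc add: Suc_diff_1)
  then show ?thesis using assms(2) by (metis int_nat_eq int_pow_int less_le_not_le)
qed

lemma Pos_int_pow_iff:
  assumes x: "x \<in> carrier G" and n: "(n::int) > 0"
  shows "x [^] n \<in> Pos \<longleftrightarrow> x \<in> Pos"
proof
  assume p: "x [^] n \<in> Pos"
  show "x \<in> Pos"
  proof (rule ccontr)
    assume "x \<notin> Pos"
    then consider "x = \<one>" | "inv x \<in> Pos" using Pos_cases[OF x] by auto
    then show False
    proof cases
      case 1 then show ?thesis using p one_not_Pos by simp
    next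
      case 2
      then have "inv (x [^] n) \<in> Pos" using Pos_int_pow[OF 2 n] x by (simp add: int_pow_inv)
      then show ?thesis using Pos_inv[OF p] by simp
    qed
  qed
qed (rule Pos_int_pow[OF _ n])

text \<open>\<open>offset u x n m\<close> is positive precisely if \<open>m / n\<close> should lie below the value of \<open>x\<close> measured in
  units of \<open>u\<close>: the rational approximations from below that define the embedding.\<close>

definition offset :: "'a \<Rightarrow> 'a \<Rightarrow> int \<Rightarrow> int \<Rightarrow> 'a" where
  "offset u x n m = x [^] n \<otimes> u [^] (- m)"

lemma offset_closed [simp]:
  "u \<in> carrier G \<Longrightarrow> x \<in> carrier G \<Longrightarrow> offset u x n m \<in> carrier G"
  by (simp add: offset_def)

text \<open>Bringing the fractions \<open>k / l\<close> and \<open>m / n\<close> to a common denominator: the rule behind every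
  comparison of two approximations.\<close>

lemma offset_pow:
  assumes "u \<in> carrier G" "x \<in> carrier G"
  shows "offset u x l k [^] (n::int) = offset u x n m [^] l \<otimes> u [^] (m * l - k * n)"
proof -
  have "offset u x l k [^] n = x [^] (l * n) \<otimes> u [^] (- k * n)"
    using assms by (simp add: offset_def int_pow_distrib int_pow_pow)
  moreover have "offset u x n m [^] l = x [^] (l * n) \<otimes> u [^] (- m * l)"
    using assms by (simp add: offset_def int_pow_distrib int_pow_pow mult.commute)
  moreover have "u [^] (- k * n) = u [^] (- m * l) \<otimes> u [^] (m * l - k * n)"
    using int_pow_mult[OF assms(1), of "- m * l" "m * l - k * n"] by simp
  ultimately show ?thesis using assms by (simp add: m_assoc)
qed

lemma offset_mono:
  assumes u: "u \<in> Pos" and x: "x \<in> carrier G" and n: "n > 0" and l: "l > 0"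
    and pos: "offset u x n m \<in> Pos" and le: "k * n \<le> m * l"
  shows "offset u x l k \<in> Pos"
proof -
  have uc: "u \<in> carrier G" using u Pos_carrier by simp
  have "offset u x n m [^] l \<in> Pos" by (rule Pos_int_pow[OF pos l])
  then have "offset u x l k [^] n \<in> Pos"
    unfolding offset_pow[OF uc x, of l k n m]
  proof (cases "k * n = m * l")
    case False
    then have "u [^] (m * l - k * n) \<in> Pos" using le by (intro Pos_int_pow[OF u]) simp
    then show "offset u x n m [^] l \<otimes> u [^] (m * l - k * n) \<in> Pos"
      using Pos_mult \<open>offset u x n m [^] l \<in> Pos\<close> by blast
  qed (auto simp: Pos_carrier)
  then show ?thesis using Pos_int_pow_iff[OF offset_closed[OF uc x] n] by simp
qed

text \<open>A fraction \<open>m / n\<close> that does not lie strictly below \<open>x\<close> may be equal to it, so only a larger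
  fraction \<open>k / l\<close> is certain to lie strictly above.\<close>

lemma offset_not_Pos:
  assumes u: "u \<in> Pos" and x: "x \<in> carrier G" and n: "n > 0" and l: "l > 0"
    and npos: "offset u x n m \<notin> Pos" and less: "m * l < k * n"
  shows "inv (offset u x l k) \<in> Pos"
proof -
  have uc: "u \<in> carrier G" using u Pos_carrier by simp
  have nn: "offset u x l k \<notin> Pos"
    using offset_mono[OF u x l n, of k m] npos less by auto
  have "offset u x l k \<noteq> \<one>"
  proof
    assume "offset u x l k = \<one>"
    then have "offset u x n m [^] l = u [^] (k * n - m * l)"
      using offset_pow[OF uc x, of n m l k] uc by simp
    also have "\<dots> \<in> Pos" using less by (intro Pos_int_pow[OF u]) simp
    finally show False using npos Pos_int_pow_iff[OF offset_closed[OF uc x] l] by simp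
  qed
  with nn show ?thesis using Pos_cases[OF offset_closed[OF uc x], of l k] by auto
qed

lemma inv_offset:
  assumes "u \<in> carrier G" "x \<in> carrier G"
  shows "inv (offset u x n m) = offset u (inv x) n (- m)"
  using assms by (simp add: offset_def inv_mult int_pow_inv int_pow_neg)

text \<open>The lower Dedekind cut of the value of \<open>x\<close> in units of \<open>u\<close>.\<close>

definition cut :: "'a \<Rightarrow> 'a \<Rightarrow> real set" where
  "cut u x = {of_int m / of_int n | m n :: int. n > 0 \<and> offset u x n m \<in> Pos}"

lemma in_cut_iff:
  assumes u: "u \<in> Pos" and x: "x \<in> carrier G" and n: "n > 0"
  shows "of_int m / of_int n \<in> cut u x \<longleftrightarrow> offset u x n m \<in> Pos"
proof
  assume "of_int m / of_int n \<in> cut u x"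
  then obtain k l :: int where l: "l > 0" and p: "offset u x l k \<in> Pos"
    and e: "of_int m / of_int n = (of_int k / of_int l :: real)"
    unfolding cut_def by blast
  from e l n have "(of_int (m * l) :: real) = of_int (k * n)" by (simp add: field_simps)
  then have "m * l = k * n" using of_int_eq_iff by blast
  with offset_mono[OF u x l n p, of m] show "offset u x n m \<in> Pos" by simp
qed (use n in \<open>auto simp: cut_def\<close>)

lemma additive_int_pow:
  fixes \<psi> :: "'a \<Rightarrow> real"
  assumes add: "\<And>x y. x \<in> carrier G \<Longrightarrow> y \<in> carrier G \<Longrightarrow> \<psi> (x \<otimes> y) = \<psi> x + \<psi> y"
    and x: "x \<in> carrier G"
  shows "\<psi> (x [^] (n::int)) = of_int n * \<psi> x"
proof -
  have one: "\<psi> \<one> = 0" using add[of \<one> \<one>] by simp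
  have nat: "\<psi> (x [^] k) = of_nat k * \<psi> x" for k :: nat
    using x by (induction k) (simp_all add: one add algebra_simps)
  have inv: "\<psi> (inv y) = - \<psi> y" if "y \<in> carrier G" for y
    using add[of y "inv y"] that one by simp
  show ?thesis
  proof (cases "n \<ge> 0")
    case True
    then show ?thesis using nat[of "nat n"] by (metis int_pow_int nat_0_le of_int_of_nat_eq)
  next
    case False
    then obtain k :: nat where "n = - int k" by (metis linear minus_minus neg_0_le_iff_le nonneg_int_cases)
    then show ?thesis using nat[of k] x inv by (simp add: int_pow_neg int_pow_int)
  qed
qed

text \<open>A positive additive map has the sign of its argument, so applied to \<open>offset u x n m\<close> it
  decides on which side of its value the fraction \<open>m / n\<close> lies. The cut therefore determines the map,
  which is the uniqueness half of Hoelder's theorem.\<close>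

lemma cut_of_additive:
  fixes \<psi> :: "'a \<Rightarrow> real"
  assumes add: "\<And>x y. x \<in> carrier G \<Longrightarrow> y \<in> carrier G \<Longrightarrow> \<psi> (x \<otimes> y) = \<psi> x + \<psi> y"
    and pos: "\<And>x. x \<in> Pos \<Longrightarrow> \<psi> x > 0" and u: "u \<in> Pos" and unit: "\<psi> u = 1"
    and x: "x \<in> carrier G"
  shows "cut u x = {q \<in> \<rat>. q < \<psi> x}"
proof -
  have uc: "u \<in> carrier G" using u Pos_carrier by simp
  have val: "\<psi> (offset u x n m) = of_int n * \<psi> x - of_int m" for n m :: int
    using uc x additive_int_pow[of \<psi>, OF add] by (simp add: offset_def add unit)
  have one: "\<psi> \<one> = 0" using add[of \<one> \<one>] by simp
  have sgn: "\<psi> y > 0 \<longleftrightarrow> y \<in> Pos" if y: "y \<in> carrier G" for y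
    using Pos_cases[OF y] pos[of y] pos[of "inv y"] add[of y "inv y"] one y
    by auto
  have mem: "of_int m / of_int n \<in> cut u x \<longleftrightarrow> of_int m / of_int n < \<psi> x" if "n > 0" for m n :: int
    using in_cut_iff[OF u x that] sgn[OF offset_closed[OF uc x], of n m] val[of n m] that
    by (simp add: field_simps)
  have rat: "\<exists>m n :: int. n > 0 \<and> q = of_int m / of_int n" if "q \<in> \<rat>" for q :: real
    using that by (metis Rats_cases')
  show ?thesis
  proof (intro equalityI subsetI)
    fix q assume q: "q \<in> cut u x"
    then obtain m n :: int where "n > 0" "q = of_int m / of_int n" unfolding cut_def by blast
    with q mem show "q \<in> {q \<in> \<rat>. q < \<psi> x}" by auto
  next
    fix q assume "q \<in> {q \<in> \<rat>. q < \<psi> x}"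
    with rat mem show "q \<in> cut u x" by blast
  qed
qed

lemma additive_unique:
  fixes \<psi> \<psi>' :: "'a \<Rightarrow> real"
  assumes "\<And>x y. x \<in> carrier G \<Longrightarrow> y \<in> carrier G \<Longrightarrow> \<psi> (x \<otimes> y) = \<psi> x + \<psi> y"
    and "\<And>x. x \<in> Pos \<Longrightarrow> \<psi> x > 0" and "\<psi> u = 1"
    and "\<And>x y. x \<in> carrier G \<Longrightarrow> y \<in> carrier G \<Longrightarrow> \<psi>' (x \<otimes> y) = \<psi>' x + \<psi>' y"
    and "\<And>x. x \<in> Pos \<Longrightarrow> \<psi>' x > 0" and "\<psi>' u = 1"
    and u: "u \<in> Pos" and x: "x \<in> carrier G"
  shows "\<psi> x = \<psi>' x"
proof -
  have eq: "{q \<in> \<rat>. q < \<psi> x} = {q \<in> \<rat>. q < \<psi>' x}"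
    using cut_of_additive[of \<psi> u x] cut_of_additive[of \<psi>' u x] assms by simp
  have "\<not> a < b" if "{q \<in> \<rat>. q < a} = {q \<in> \<rat>. q < b}" for a b :: real
  proof
    assume "a < b"
    then obtain q where "q \<in> \<rat>" "a < q" "q < b" using Rats_dense_in_real by blast
    then have "q \<in> {q \<in> \<rat>. q < b}" by simp
    then have "q \<in> {q \<in> \<rat>. q < a}" unfolding that .
    with \<open>a < q\<close> show False by simp
  qed
  from this[OF eq] this[OF eq[symmetric]] show ?thesis by simp
qed

text \<open>The map is the supremum of the cut. Adding approximations with a common denominator shows that it
  is superadditive. The reverse inequality follows from superadditivity applied to \<open>inv x\<close> and \<open>x \<otimes> y\<close>,
  once the value of \<open>inv x\<close> is known to be at least the negative of that of \<open>x\<close>; this holds because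
  fractions above \<open>x\<close> become fractions below \<open>inv x\<close>.\<close>

theorem additive_exists:
  assumes u: "u \<in> Pos"
  shows "\<exists>\<phi> :: 'a \<Rightarrow> real. (\<forall>x\<in>carrier G. \<forall>y\<in>carrier G. \<phi> (x \<otimes> y) = \<phi> x + \<phi> y) \<and>
    (\<forall>x\<in>Pos. \<phi> x > 0) \<and> \<phi> u = 1"
proof -
  have uc: "u \<in> carrier G" using u Pos_carrier by simp
  define \<phi> where "\<phi> x = Sup (cut u x)" for x
  have offs1: "offset u x 1 m = x \<otimes> inv (u [^] m)" if "x \<in> carrier G" for x m
    using that uc by (simp add: offset_def int_pow_neg)
  have below: "\<exists>m. offset u x 1 m \<in> Pos" if x: "x \<in> carrier G" for x
  proof -
    obtain n :: nat where "u [^] n \<otimes> inv (inv x) \<in> Pos" using archimedean[OF u, of "inv x"] x by auto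
    then have "offset u x 1 (- int n) \<in> Pos"
      using x uc by (simp add: offset_def int_pow_int m_comm)
    then show ?thesis by blast
  qed
  have ne: "cut u x \<noteq> {}" if x: "x \<in> carrier G" for x
    using below[OF x] unfolding cut_def by fastforce
  have upper: "r < of_int k / of_int l"
    if x: "x \<in> carrier G" and l: "l > 0" and p: "offset u x l k \<notin> Pos" and r: "r \<in> cut u x"
      and neq: "r \<noteq> of_int k / of_int l" for x r k l
  proof -
    obtain m n :: int where n: "n > 0" "r = of_int m / of_int n" "offset u x n m \<in> Pos"
      using r unfolding cut_def by blast
    have "\<not> k * n \<le> m * l" using offset_mono[OF u x n(1) l n(3)] p by blast
    then have "m * l < k * n" by simp
    then have "(of_int (m * l) :: real) < of_int (k * n)" using of_int_less_iff by blast
    then show ?thesis using n(1,2) l by (simp add: divide_less_eq less_divide_eq mult.commute)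
  qed
  have bdd: "bdd_above (cut u x)" if x: "x \<in> carrier G" for x
  proof -
    obtain m where "offset u (inv x) 1 m \<in> Pos" using below[of "inv x"] x by auto
    then have "inv (offset u (inv x) 1 m) \<notin> Pos" by (rule Pos_inv)
    then have "offset u x 1 (- m) \<notin> Pos" using x uc by (simp add: inv_offset)
    from upper[OF x _ this] show ?thesis
      by (intro bdd_aboveI[of _ "of_int (- m)"]) force
  qed
  have le: "r \<le> \<phi> x" if "x \<in> carrier G" "r \<in> cut u x" for x r
    unfolding \<phi>_def using that bdd by (intro cSup_upper)
  have super: "\<phi> x + \<phi> y \<le> \<phi> (x \<otimes> y)" if x: "x \<in> carrier G" and y: "y \<in> carrier G" for x y
  proof -
    have sum: "r + s \<le> \<phi> (x \<otimes> y)" if r: "r \<in> cut u x" and s: "s \<in> cut u y" for r s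
    proof -
      obtain m n :: int where n: "n > 0" "r = of_int m / of_int n" "offset u x n m \<in> Pos"
        using r unfolding cut_def by blast
      obtain k l :: int where l: "l > 0" "s = of_int k / of_int l" "offset u y l k \<in> Pos"
        using s unfolding cut_def by blast
      have "offset u x (n * l) (m * l) \<in> Pos"
        by (rule offset_mono[OF u x n(1) _ n(3)]) (use n l in auto)
      moreover have "offset u y (n * l) (k * n) \<in> Pos"
        by (rule offset_mono[OF u y l(1) _ l(3)]) (use n l in auto)
      moreover have "offset u x (n * l) (m * l) \<otimes> offset u y (n * l) (k * n)
          = offset u (x \<otimes> y) (n * l) (m * l + k * n)"
      proof -
        have "u [^] (- (m * l + k * n)) = u [^] (- (m * l)) \<otimes> u [^] (- (k * n))"
          using int_pow_mult[OF uc, of "- (m * l)" "- (k * n)"] by simp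
        then show ?thesis using x y uc by (simp add: offset_def int_pow_distrib m_ac)
      qed
      ultimately have "offset u (x \<otimes> y) (n * l) (m * l + k * n) \<in> Pos"
        using Pos_mult by metis
      then have "of_int (m * l + k * n) / of_int (n * l) \<in> cut u (x \<otimes> y)"
        using mult_pos_pos[OF n(1) l(1)] m_closed[OF x y] in_cut_iff[OF u, of "x \<otimes> y" "n * l" "m * l + k * n"] by blast
      moreover have "of_int (m * l + k * n) / of_int (n * l) = r + s"
        using n l by (simp add: field_simps)
      ultimately show ?thesis using le x y by auto
    qed
    have "\<phi> x \<le> \<phi> (x \<otimes> y) - s" if "s \<in> cut u y" for s
      unfolding \<phi>_def[of x] by (rule cSup_least[OF ne[OF x]]) (use sum that in \<open>simp add: algebra_simps\<close>)
    then have "\<phi> y \<le> \<phi> (x \<otimes> y) - \<phi> x"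
      unfolding \<phi>_def[of y] by (intro cSup_least[OF ne[OF y]]) (simp add: algebra_simps)
    then show ?thesis by simp
  qed
  have one: "\<phi> \<one> \<le> 0"
    unfolding \<phi>_def
  proof (rule cSup_least[OF ne])
    fix r assume r: "r \<in> cut u \<one>"
    show "r \<le> 0" using upper[of \<one> 1 0 r] r one_not_Pos uc by (force simp: offset_def)
  qed simp
  have inv_ge: "- \<phi> x \<le> \<phi> (inv x)" if x: "x \<in> carrier G" for x
  proof (rule ccontr)
    assume "\<not> ?thesis"
    then have "\<phi> x < - \<phi> (inv x)" by simp
    then obtain r where r: "r \<in> \<rat>" "\<phi> x < r" "r < - \<phi> (inv x)" using Rats_dense_in_real by blast
    \<comment> \<open>A second fraction \<open>s\<close> above \<open>r\<close> makes the offset strictly negative, not merely non-positive.\<close>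
    obtain s where s: "s \<in> \<rat>" "r < s" "s < - \<phi> (inv x)" using r Rats_dense_in_real by blast
    obtain m n :: int where n: "n > 0" "r = of_int m / of_int n" using r by (metis Rats_cases')
    obtain k l :: int where l: "l > 0" "s = of_int k / of_int l" using s by (metis Rats_cases')
    have "offset u x n m \<notin> Pos" using le[OF x] r n in_cut_iff[OF u x n(1)] by fastforce
    moreover have "(of_int (m * l) :: real) < of_int (k * n)" using s n l by (simp add: field_simps)
    then have "m * l < k * n" using of_int_less_iff by blast
    ultimately have "inv (offset u x l k) \<in> Pos" using offset_not_Pos[OF u x n(1) l(1)] by blast
    then have "offset u (inv x) l (- k) \<in> Pos" using inv_offset uc x by simp
    then have "of_int (- k) / of_int l \<in> cut u (inv x)" using in_cut_iff[OF u _ l(1)] x by blast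
    from le[OF _ this] x l s show False by simp
  qed
  have add: "\<phi> (x \<otimes> y) = \<phi> x + \<phi> y" if x: "x \<in> carrier G" and y: "y \<in> carrier G" for x y
  proof (rule antisym)
    have "\<phi> (inv x) + \<phi> (x \<otimes> y) \<le> \<phi> (inv x \<otimes> (x \<otimes> y))" using super x y by simp
    also have "inv x \<otimes> (x \<otimes> y) = y" using x y by (simp add: m_assoc[symmetric])
    finally show "\<phi> (x \<otimes> y) \<le> \<phi> x + \<phi> y" using inv_ge[OF x] by simp
  qed (rule super[OF x y])
  have pos: "\<phi> x > 0" if x: "x \<in> Pos" for x
  proof -
    have xc: "x \<in> carrier G" using x Pos_carrier by simp
    obtain n :: nat where n: "x [^] n \<otimes> inv u \<in> Pos" using archimedean[OF x uc] by blast
    have "n \<noteq> 0" using n Pos_inv[OF u] uc by (cases n) auto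
    moreover have "offset u x (int n) 1 \<in> Pos" using n xc uc by (simp add: offset_def int_pow_int int_pow_neg)
    ultimately have "of_int 1 / of_int (int n) \<in> cut u x" using in_cut_iff[OF u xc, of "int n" 1] by simp
    from le[OF xc this] \<open>n \<noteq> 0\<close> show ?thesis by (smt (verit) of_int_1 of_int_of_nat_eq of_nat_0_less_iff zero_less_divide_1_iff bot_nat_0.not_eq_extremum)
  qed
  have unit: "\<phi> u = 1"
  proof (rule antisym)
    show "\<phi> u \<le> 1" unfolding \<phi>_def
    proof (rule cSup_least[OF ne[OF uc]])
      fix r assume r: "r \<in> cut u u"
      have "offset u u 1 1 = \<one>" using uc by (simp add: offset_def int_pow_neg)
      with upper[OF uc, of 1 1 r] r one_not_Pos show "r \<le> 1" by force
    qed
    show "1 \<le> \<phi> u"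
    proof (rule ccontr)
      assume "\<not> 1 \<le> \<phi> u"
      then obtain r where r: "r \<in> \<rat>" "\<phi> u < r" "r < 1" using Rats_dense_in_real[of "\<phi> u" 1] by auto
      obtain m n :: int where n: "n > 0" "r = of_int m / of_int n" using r by (metis Rats_cases')
      have "offset u u n m = u [^] (n - m)"
        using uc int_pow_mult[OF uc, of n "- m"] by (simp add: offset_def)
      moreover have "m < n" using r n by (simp add: field_simps)
      ultimately have "offset u u n m \<in> Pos" using Pos_int_pow[OF u] by simp
      then have "r \<in> cut u u" using in_cut_iff[OF u uc n(1)] n by simp
      from le[OF uc this] r show False by simp
    qed
  qed
  from add pos unit show ?thesis by blast
qed

end

section \<open>Congruence of intervals\<close>

context congruent_intervals
begin

lemma same_pitch_refl [simp]: "x \<sim> x"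
  by (simp add: same_pitch_def lower_irrefl)

lemma same_pitch_sym: "x \<sim> y \<Longrightarrow> y \<sim> x"
  by (simp add: same_pitch_def)

lemma same_pitch_trans:
  assumes "x \<sim> y" "y \<sim> z" shows "x \<sim> z"
proof -
  have "\<not> x \<prec> z" using lower_separates[of x z] assms(1) same_pitch_sym[OF assms(2)] by blast
  moreover have "\<not> z \<prec> x" using lower_separates[of z x] assms(1) same_pitch_sym[OF assms(2)] by blast
  ultimately show ?thesis by (simp add: same_pitch_def)
qed

lemma lower_cases: "x \<prec> y \<or> x \<sim> y \<or> y \<prec> x"
  by (auto simp: same_pitch_def)

lemma lower_same_pitch_trans: "x \<prec> y \<Longrightarrow> y \<sim> z \<Longrightarrow> x \<prec> z"
  using same_pitch_trans[of x z y] lower_trans[of z x y] same_pitch_sym[of y z]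
  by (auto simp: same_pitch_def)

lemma same_pitch_lower_trans: "x \<sim> y \<Longrightarrow> y \<prec> z \<Longrightarrow> x \<prec> z"
  using same_pitch_trans[of y x z] lower_trans[of y z x] same_pitch_sym[of x y]
  by (auto simp: same_pitch_def)

lemma pitch_class_eq_iff: "pitch_class x = pitch_class y \<longleftrightarrow> x \<sim> y"
  unfolding pitch_class_def using same_pitch_sym same_pitch_trans same_pitch_refl by blast

lemma ivl_eq_iff: "ivl a b = ivl c d \<longleftrightarrow> a \<sim> c \<and> b \<sim> d"
  by (simp add: ivl_def pitch_class_eq_iff)

lemma ivl_in_intervals [simp]: "ivl a b \<in> intervals"
  by (auto simp: ivl_def intervals_def pitch_class_def quotient_def)

lemma intervals_cases:
  assumes "I \<in> intervals" obtains a b where "I = ivl a b"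
  using assms by (auto simp: ivl_def intervals_def pitch_class_def quotient_def)

abbreviation ivl_cong where "ivl_cong a b c d \<equiv> cong (ivl a b) (ivl c d)"

lemma ivl_cong_refl [simp]: "ivl_cong a b a b"
  by (simp add: cong_refl)

lemma cong_target_unique: "ivl_cong x y a b \<Longrightarrow> ivl_cong x y a b' \<Longrightarrow> b \<sim> b'"
  using cong_transfer[of x y a] same_pitch_sym same_pitch_trans by blast

text \<open>Symmetry is not an axiom. Transfer \<open>[c, d]\<close> back to the starting point \<open>a\<close>: by transitivity and
  the uniqueness of the transfer of \<open>[a, b]\<close> to \<open>a\<close>, this can only give \<open>[a, b]\<close>.\<close>

lemma cong_sym: "ivl_cong a b c d \<Longrightarrow> ivl_cong c d a b"
proof -
  assume c: "ivl_cong a b c d"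
  obtain e where e: "ivl_cong c d a e" using cong_transfer by blast
  then have "b \<sim> e" using c cong_trans cong_target_unique[of a b a b e] by auto
  then have "ivl a e = ivl a b" by (simp add: ivl_eq_iff same_pitch_sym)
  with e show ?thesis by simp
qed

lemma cong_higher:
  assumes "b \<prec> a" and "ivl_cong a b c d" shows "d \<prec> c"
  using cong_reverse[OF assms(1)] cong_lower[OF assms(1)] assms(2) by blast

lemma cong_same_pitch: "a \<sim> b \<Longrightarrow> ivl_cong a b c d \<Longrightarrow> c \<sim> d"
  using cong_lower[of c d a b] cong_higher[of d c a b] cong_sym[of a b c d]
  by (auto simp: same_pitch_def)

lemma cong_same_pitchI:
  assumes "a \<sim> b" "c \<sim> d" shows "ivl_cong a b c d"
proof -
  obtain e where e: "ivl_cong a b c e" using cong_transfer by blast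
  then have "d \<sim> e" using cong_same_pitch assms same_pitch_sym same_pitch_trans by blast
  then have "ivl c e = ivl c d" by (simp add: ivl_eq_iff same_pitch_sym)
  with e show ?thesis by simp
qed

lemma cong_rev: "ivl_cong a b c d \<Longrightarrow> ivl_cong b a d c"
  using lower_cases[of a b] cong_reverse[of a b c d] cong_reverse[of b a d c]
    cong_same_pitch[of a b c d] cong_same_pitchI[of b a d c] same_pitch_sym
  by blast

text \<open>The axiom covers intervals that ascend one after the other. Uniqueness of transfer turns it into
  two cancellation rules, and every other position of three distinct pitches is one of these
  rules or the axiom, read forwards or reversed; degenerate positions are immediate.\<close>

lemma cong_append:
  assumes ab: "ivl_cong a b a' b'" and bc: "ivl_cong b c b' c'"
  shows "ivl_cong a c a' c'"
proof -
  have cancel_left: "ivl_cong y z y' z'"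
    if "x \<prec> y" "y \<prec> z" "ivl_cong x y x' y'" "ivl_cong x z x' z'" for x y z x' y' z'
  proof -
    obtain w where w: "ivl_cong y z y' w" using cong_transfer by blast
    then have "ivl_cong x z x' w" using cong_compose that by blast
    then have "w \<sim> z'" using that(4) cong_target_unique by blast
    then have "ivl y' w = ivl y' z'" by (simp add: ivl_eq_iff)
    with w show ?thesis by simp
  qed
  have cancel_right: "ivl_cong x y x' y'"
    if "x \<prec> y" "y \<prec> z" "ivl_cong x z x' z'" "ivl_cong y z y' z'" for x y z x' y' z'
  proof -
    obtain w where w: "ivl_cong x y x' w" using cong_transfer by blast
    then have "ivl_cong y z w z'" using cancel_left that by blast
    then have "ivl_cong z y z' w" by (rule cong_rev)
    moreover have "ivl_cong z y z' y'" using that(4) by (rule cong_rev)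
    ultimately have "w \<sim> y'" using cong_target_unique by blast
    then have "ivl x' w = ivl x' y'" by (simp add: ivl_eq_iff)
    with w show ?thesis by simp
  qed
  show ?thesis
  proof -
    consider "a \<sim> b" | "b \<sim> c" | "a \<sim> c" | "a \<prec> b" "b \<prec> c" | "c \<prec> b" "b \<prec> a"
      | "a \<prec> c" "c \<prec> b" | "b \<prec> c" "c \<prec> a" | "c \<prec> a" "a \<prec> b" | "b \<prec> a" "a \<prec> c"
      using lower_cases by metis
    then show ?thesis
    proof cases
      case 1
      then have "ivl b c = ivl a c" "ivl b' c' = ivl a' c'"
        using cong_same_pitch[OF 1 ab] by (auto simp: ivl_eq_iff same_pitch_sym)
      with bc show ?thesis by simp
    next
      case 2
      then have "ivl a b = ivl a c" "ivl a' b' = ivl a' c'"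
        using cong_same_pitch[OF 2 bc] by (auto simp: ivl_eq_iff)
      with ab show ?thesis by simp
    next
      case 3
      have "ivl b c = ivl b a" using 3 by (simp add: ivl_eq_iff same_pitch_sym)
      then have "c' \<sim> a'" using bc cong_rev[OF ab] cong_target_unique by simp
      with 3 show ?thesis using cong_same_pitchI same_pitch_sym by blast
    next
      case 4
      then show ?thesis using cong_compose ab bc by blast
    next
      case 5
      then have "ivl_cong c a c' a'" using cong_compose cong_rev[OF ab] cong_rev[OF bc] by blast
      then show ?thesis by (rule cong_rev)
    next
      case 6
      then show ?thesis using cancel_right[OF 6 ab cong_rev[OF bc]] by blast
    next
      case 7
      then show ?thesis using cancel_left[OF 7 bc cong_rev[OF ab]] cong_rev by blast
    next
      case 8
      from cancel_right[OF 8 cong_rev[OF bc] ab] show ?thesis by (rule cong_rev)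
    next
      case 9
      from cancel_left[OF 9 cong_rev[OF ab] bc] show ?thesis .
    qed
  qed
qed

text \<open>The composition axiom for inverses says that composing two ascending intervals in either order
  gives congruent results: \<open>[b, c]\<close> is first laid off from \<open>a\<close>, up to \<open>d\<close>, and then \<open>[a, b]\<close> from \<open>d\<close>.
  This is the only source of commutativity.\<close>

lemma cong_commute:
  assumes ab: "a \<prec> b" and bc: "b \<prec> c" and "ivl_cong a b d c'" and "ivl_cong b c a d"
  shows "ivl_cong a c a c'"
proof -
  have "cong (ivl a b) (prod.swap (ivl c' d))" "cong (ivl b c) (prod.swap (ivl d a))"
    using assms by (simp_all add: ivl_def)
  then have "cong (ivl a c) (prod.swap (ivl c' a))" using cong_compose_inverse[OF ab bc] by blast
  then show ?thesis by (simp add: ivl_def)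
qed

section \<open>The ordered group of interval classes\<close>

definition interval_class :: "'a \<Rightarrow> 'a \<Rightarrow> 'a interval set" where
  "interval_class a b = {I. cong (ivl a b) I}"

lemma interval_class_eq_iff: "interval_class a b = interval_class c d \<longleftrightarrow> ivl_cong a b c d"
proof
  assume "interval_class a b = interval_class c d"
  then show "ivl_cong a b c d" using cong_sym ivl_cong_refl unfolding interval_class_def by blast
next
  assume "ivl_cong a b c d"
  then show "interval_class a b = interval_class c d"
    unfolding interval_class_def using cong_trans cong_sym by blast
qed

text \<open>Composition is laying intervals end to end. The description in the product is
  meaningful because every class contains an interval from any given sound, and the result does
  not depend on that sound by \<open>cong_append\<close>. The unit is the class of the degenerate intervals; the
  choice of the sound \<open>undefined\<close> in it is immaterial.\<close>

definition interval_group :: "'a interval set monoid" where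
  "interval_group = \<lparr>carrier = {interval_class a b | a b. True},
     monoid.mult = (\<lambda>X Y. THE Z. \<exists>a b c. X = interval_class a b \<and> Y = interval_class b c \<and> Z = interval_class a c),
     one = interval_class undefined undefined\<rparr>"

lemma interval_class_carrier [simp]: "interval_class a b \<in> carrier interval_group"
  by (auto simp: interval_group_def)

lemma interval_class_from:
  assumes "X \<in> carrier interval_group" obtains b where "X = interval_class a b"
proof -
  obtain c d where "X = interval_class c d" using assms by (auto simp: interval_group_def)
  moreover obtain b where "ivl_cong c d a b" using cong_transfer by blast
  ultimately show ?thesis using that interval_class_eq_iff by blast
qed

lemma interval_class_to:
  assumes "X \<in> carrier interval_group" obtains b where "X = interval_class b a"
proof -
  obtain c d where c: "X = interval_class c d" using assms by (auto simp: interval_group_def)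
  obtain b where "ivl_cong d c a b" using cong_transfer by blast
  then show ?thesis using that c interval_class_eq_iff cong_rev by blast
qed

lemma interval_class_mult:
  "interval_class a b \<otimes>\<^bsub>interval_group\<^esub> interval_class b c = interval_class a c"
proof -
  have "(THE Z. \<exists>a' b' c'. interval_class a b = interval_class a' b' \<and>
      interval_class b c = interval_class b' c' \<and> Z = interval_class a' c') = interval_class a c"
    by (rule the_equality) (use cong_append interval_class_eq_iff in \<open>blast+\<close>)
  then show ?thesis by (simp add: interval_group_def)
qed

lemma interval_class_one: "interval_class a b = \<one>\<^bsub>interval_group\<^esub> \<longleftrightarrow> a \<sim> b"
  using cong_same_pitchI[of undefined undefined] cong_same_pitch[of undefined undefined]
    interval_class_eq_iff[of undefined undefined a b]
  by (auto simp: interval_group_def)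

text \<open>The exchange law \<open>[a, b] \<cong> [d, c] \<Longrightarrow> [a, d] \<cong> [b, c]\<close> says that the opposite sides of a
  parallelogram are congruent, which is commutativity. \<open>swap\<close> is the exchange law for ascending \<open>[a, b]\<close>
  with \<open>b\<close> below \<open>c\<close>, where the inverse composition axiom applies; the other positions reduce to it
  by symmetry and reversal.\<close>

lemma interval_class_mult_commute:
  assumes "X \<in> carrier interval_group" "Y \<in> carrier interval_group"
  shows "X \<otimes>\<^bsub>interval_group\<^esub> Y = Y \<otimes>\<^bsub>interval_group\<^esub> X"
proof -
  note mult = interval_class_mult and eq = interval_class_eq_iff
  have swap: "ivl_cong a d b c" if "ivl_cong a b d c" "a \<prec> b" "b \<prec> c" for a b c d
  proof -
    obtain e where e: "ivl_cong b c a e" using cong_transfer by blast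
    obtain f where f: "ivl_cong a b e f" using cong_transfer by blast
    have "ivl_cong a c a f" using cong_commute[OF that(2,3) f e] .
    then have cf: "c \<sim> f" using cong_target_unique[of a c a c f] by simp
    have "ivl_cong b a c d" using that(1) by (rule cong_rev)
    moreover have "ivl f e = ivl c e" using cf by (simp add: ivl_eq_iff same_pitch_sym)
    then have "ivl_cong b a c e" using cong_rev[OF f] by simp
    ultimately have "d \<sim> e" using cong_target_unique by blast
    then have "ivl a d = ivl a e" by (simp add: ivl_eq_iff)
    then show ?thesis using cong_sym[OF e] by simp
  qed
  have swap_up: "ivl_cong a d b c" if h: "ivl_cong a b d c" "a \<prec> b" for a b c d
  proof -
    consider "b \<prec> c" | "b \<sim> c" | "c \<prec> b" using lower_cases by blast
    then show ?thesis
    proof cases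
      case 1 with swap h show ?thesis by blast
    next
      case 2
      then have "ivl c d = ivl b d" by (simp add: ivl_eq_iff same_pitch_sym)
      then have "ivl_cong b a b d" using cong_rev[OF h(1)] by simp
      then have "a \<sim> d" using cong_target_unique[of b a b a d] by simp
      then show ?thesis using 2 cong_same_pitchI by blast
    next
      case 3
      \<comment> \<open>The roles of the two congruent sides are exchanged: now \<open>[d, c]\<close> lies below \<open>b\<close>.\<close>
      have "d \<prec> c" using cong_lower h by blast
      have "ivl_cong d a c b" using swap[OF cong_sym[OF h(1)] \<open>d \<prec> c\<close> 3] .
      then show ?thesis by (rule cong_rev)
    qed
  qed
  have swap_all: "ivl_cong a d b c" if h: "ivl_cong a b d c" for a b c d
  proof -
    consider "a \<prec> b" | "a \<sim> b" | "b \<prec> a" using lower_cases by blast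
    then show ?thesis
    proof cases
      case 1 with swap_up h show ?thesis by blast
    next
      case 2
      then have "d \<sim> c" using cong_same_pitch h by blast
      with 2 have "ivl a d = ivl b c" by (simp add: ivl_eq_iff)
      then show ?thesis by simp
    next
      case 3
      have "ivl_cong b c a d" using swap_up[OF cong_rev[OF h] 3] .
      then show ?thesis by (rule cong_sym)
    qed
  qed
  obtain b where b: "X = interval_class undefined b" using interval_class_from assms(1) by blast
  obtain c where c: "Y = interval_class b c" using interval_class_from assms(2) by blast
  obtain d where d: "X = interval_class d c" using interval_class_to assms(1) by blast
  have "ivl_cong undefined d b c" using swap_all b d eq by metis
  then have "Y = interval_class undefined d" using c eq by blast
  then show ?thesis using mult[of undefined b c] mult[of undefined d c] b c d by simp
qed

lemma interval_comm_group: "comm_group interval_group"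
proof (rule comm_groupI)
  fix X Y Z
  assume X: "X \<in> carrier interval_group" and Y: "Y \<in> carrier interval_group"
  obtain b where b: "X = interval_class undefined b" using interval_class_from X by blast
  obtain c where c: "Y = interval_class b c" using interval_class_from Y by blast
  show "X \<otimes>\<^bsub>interval_group\<^esub> Y \<in> carrier interval_group"
    unfolding b c interval_class_mult by simp
  show "X \<otimes>\<^bsub>interval_group\<^esub> Y = Y \<otimes>\<^bsub>interval_group\<^esub> X"
    by (rule interval_class_mult_commute[OF X Y])
  assume "Z \<in> carrier interval_group"
  then obtain d where d: "Z = interval_class c d" using interval_class_from by blast
  show "X \<otimes>\<^bsub>interval_group\<^esub> Y \<otimes>\<^bsub>interval_group\<^esub> Z
      = X \<otimes>\<^bsub>interval_group\<^esub> (Y \<otimes>\<^bsub>interval_group\<^esub> Z)"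
    unfolding b c d by (simp add: interval_class_mult)
next
  have one: "\<one>\<^bsub>interval_group\<^esub> = interval_class a a" for a
    using interval_class_one[of a a] by simp
  show "\<one>\<^bsub>interval_group\<^esub> \<in> carrier interval_group" unfolding one[of undefined] by simp
  fix X assume X: "X \<in> carrier interval_group"
  obtain b where b: "X = interval_class undefined b" using interval_class_from X by blast
  show "\<one>\<^bsub>interval_group\<^esub> \<otimes>\<^bsub>interval_group\<^esub> X = X"
    unfolding b one[of undefined] by (simp add: interval_class_mult)
  have "interval_class b undefined \<otimes>\<^bsub>interval_group\<^esub> X = \<one>\<^bsub>interval_group\<^esub>"
    unfolding b one[of b] by (simp add: interval_class_mult)
  then show "\<exists>Y\<in>carrier interval_group. Y \<otimes>\<^bsub>interval_group\<^esub> X = \<one>\<^bsub>interval_group\<^esub>"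
    by (intro bexI) auto
qed

definition ascending :: "'a interval set set" where
  "ascending = {interval_class a b | a b. a \<prec> b}"

lemma interval_class_ascending: "interval_class a b \<in> ascending \<longleftrightarrow> a \<prec> b"
  unfolding ascending_def using interval_class_eq_iff cong_lower cong_sym by blast

lemma interval_class_inv: "inv\<^bsub>interval_group\<^esub> interval_class a b = interval_class b a"
proof -
  interpret comm_group interval_group by (rule interval_comm_group)
  have "interval_class b a \<otimes>\<^bsub>interval_group\<^esub> interval_class a b = \<one>\<^bsub>interval_group\<^esub>"
    by (simp add: interval_class_mult interval_class_one)
  then show ?thesis by (rule inv_equality) simp_all
qed

text \<open>If the multiples \<open>p n\<close> of an ascending step \<open>X\<close> from a sound never passed \<open>c\<close>, the sounds below some
  multiple would form a proper lower part. Going one step \<open>X\<close> down from the cut \<open>\<theta>\<close> leads to a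
  sound \<open>e\<close> below some \<open>p n\<close>; going up again puts \<open>\<theta>\<close> below \<open>p (Suc n)\<close>, which is itself below the
  next multiple and so should not lie above the cut.\<close>

lemma interval_group_archimedean:
  assumes X: "X \<in> ascending" and Y: "Y \<in> carrier interval_group"
  shows "\<exists>n::nat. X [^]\<^bsub>interval_group\<^esub> n \<otimes>\<^bsub>interval_group\<^esub> inv\<^bsub>interval_group\<^esub> Y \<in> ascending"
proof (rule ccontr)
  interpret comm_group interval_group by (rule interval_comm_group)
  assume contra: "\<not> ?thesis"
  have Xc: "X \<in> carrier interval_group" using X by (auto simp: ascending_def)
  obtain c where c: "Y = interval_class undefined c" using interval_class_from Y by blast
  define p where "p = rec_nat undefined (\<lambda>_ s. SOME t. X = interval_class s t)"
  have step: "X = interval_class (p n) (p (Suc n))" for n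
    using someI_ex[of "\<lambda>t. X = interval_class (p n) t"] interval_class_from[OF Xc, of "p n"]
    by (auto simp: p_def)
  have up: "p n \<prec> p (Suc n)" for n using step X interval_class_ascending by metis
  have pow: "X [^]\<^bsub>interval_group\<^esub> n = interval_class (p 0) (p n)" for n :: nat
  proof (induction n)
    case 0 then show ?case using interval_class_one[of "p 0" "p 0"] by simp
  next
    case (Suc n)
    then show ?case using step[of n] interval_class_mult[of "p 0" "p n" "p (Suc n)"] by simp
  qed
  have p0: "p 0 = undefined" by (simp add: p_def)
  have above: "\<not> c \<prec> p n" for n
  proof
    assume "c \<prec> p n"
    moreover have "X [^]\<^bsub>interval_group\<^esub> n \<otimes>\<^bsub>interval_group\<^esub> inv\<^bsub>interval_group\<^esub> Y
        = interval_class c (p n)"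
    proof -
      have "interval_class undefined (p n) \<otimes>\<^bsub>interval_group\<^esub> interval_class c undefined
          = interval_class c undefined \<otimes>\<^bsub>interval_group\<^esub> interval_class undefined (p n)"
        by (rule m_comm) simp_all
      then show ?thesis unfolding pow p0 c interval_class_inv by (simp add: interval_class_mult)
    qed
    ultimately show False using contra interval_class_ascending by metis
  qed
  define L where "L = {s. \<exists>n. s \<prec> p n}"
  obtain \<theta> where low: "\<And>s. s \<prec> \<theta> \<Longrightarrow> s \<in> L" and high: "\<And>s. \<theta> \<prec> s \<Longrightarrow> s \<in> - L"
  proof -
    have "p 0 \<in> L" using up L_def by blast
    moreover have "c \<in> - L" using above L_def by blast
    moreover have "\<not> q \<prec> r" if "r \<in> L" "q \<in> - L" for q r
      using that lower_trans unfolding L_def by blast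
    ultimately have "\<exists>\<theta>. (\<forall>s. s \<prec> \<theta> \<longrightarrow> s \<in> L) \<and> (\<forall>s. \<theta> \<prec> s \<longrightarrow> s \<in> - L)"
      by (intro dedekind) auto
    then show ?thesis using that by blast
  qed
  obtain e where e: "X = interval_class e \<theta>" using interval_class_to[OF Xc] by blast
  have "e \<prec> \<theta>" using e X interval_class_ascending by metis
  then obtain n where n: "e \<prec> p n" using low L_def by blast
  have "interval_class \<theta> (p (Suc n)) = interval_class \<theta> e \<otimes>\<^bsub>interval_group\<^esub>
      (interval_class e (p n) \<otimes>\<^bsub>interval_group\<^esub> interval_class (p n) (p (Suc n)))"
    by (simp add: interval_class_mult)
  also have "\<dots> = interval_class e (p n) \<otimes>\<^bsub>interval_group\<^esub>
      (interval_class \<theta> e \<otimes>\<^bsub>interval_group\<^esub> X)"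
    using step[of n] by (simp add: m_lcomm)
  also have "interval_class \<theta> e \<otimes>\<^bsub>interval_group\<^esub> X = interval_class \<theta> \<theta>"
    unfolding e by (rule interval_class_mult)
  also have "\<dots> = \<one>\<^bsub>interval_group\<^esub>" by (simp add: interval_class_one)
  finally have "interval_class \<theta> (p (Suc n)) = interval_class e (p n)" by simp
  then have "\<theta> \<prec> p (Suc n)" using n interval_class_ascending by metis
  then show False using high up[of "Suc n"] L_def by blast
qed

lemma interval_archimedean_ordered_group: "archimedean_ordered_group interval_group ascending"
proof -
  interpret comm_group interval_group by (rule interval_comm_group)
  show ?thesis
  proof
    fix X Y assume X: "X \<in> ascending" and Y: "Y \<in> ascending"
    obtain a b where a: "X = interval_class a b" "a \<prec> b" using X by (auto simp: ascending_def)
    then show "X \<in> carrier interval_group" by simp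
    have "Y \<in> carrier interval_group" using Y by (auto simp: ascending_def)
    then obtain c where c: "Y = interval_class b c" using interval_class_from by blast
    then have "b \<prec> c" using Y interval_class_ascending by simp
    then show "X \<otimes>\<^bsub>interval_group\<^esub> Y \<in> ascending"
      unfolding a c interval_class_mult interval_class_ascending using a(2) lower_trans by blast
  next
    show "\<one>\<^bsub>interval_group\<^esub> \<notin> ascending"
      using interval_class_one[of undefined undefined] interval_class_ascending[of undefined undefined]
        lower_irrefl by simp
  next
    fix X assume "X \<in> carrier interval_group"
    then obtain b where "X = interval_class undefined b" using interval_class_from by blast
    then show "X \<in> ascending \<or> X = \<one>\<^bsub>interval_group\<^esub> \<or> inv\<^bsub>interval_group\<^esub> X \<in> ascending"
      using lower_cases by (simp add: interval_class_one interval_class_inv interval_class_ascending)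
  next
    fix X Y assume "X \<in> ascending" "Y \<in> carrier interval_group"
    then show "\<exists>n::nat. X [^]\<^bsub>interval_group\<^esub> n \<otimes>\<^bsub>interval_group\<^esub> inv\<^bsub>interval_group\<^esub> Y \<in> ascending"
      by (rule interval_group_archimedean)
  qed
qed

end

section \<open>Existence and uniqueness of the measure\<close>

context tonality
begin

lemma equitonal_sym: "x \<simeq> y \<Longrightarrow> y \<simeq> x"
  using equitonal_common[of y y x] equitonal_if_same_pitch[of y y] by simp

lemma equitonal_trans: "x \<simeq> y \<Longrightarrow> y \<simeq> z \<Longrightarrow> x \<simeq> z"
  using equitonal_common[of x y z] equitonal_sym by blast

lemma tone_eq_iff: "tone s = tone t \<longleftrightarrow> s \<simeq> t"
  unfolding tone_def using equitonal_sym equitonal_trans equitonal_if_same_pitch[of _ _, OF same_pitch_refl]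
  by blast

lemma octave_interval_iff: "octave_interval (ivl s t) \<longleftrightarrow> is_octave_of s t"
proof
  assume "octave_interval (ivl s t)"
  then obtain s' t' where o: "is_octave_of s' t'" and s: "s \<sim> s'" and t: "t \<sim> t'"
    by (auto simp: octave_interval_def ivl_eq_iff)
  have ss: "s \<simeq> s'" "t \<simeq> t'" using s t equitonal_if_same_pitch by blast+
  have "t \<simeq> s" using o ss equitonal_sym equitonal_trans unfolding is_octave_of_def by blast
  moreover have "s \<prec> t" using o s t lower_same_pitch_trans same_pitch_lower_trans same_pitch_sym
    unfolding is_octave_of_def by blast
  moreover have "\<not> x \<prec> t" if "x \<simeq> s" "s \<prec> x" for x
  proof -
    have "x \<simeq> s'" "s' \<prec> x" using that ss(1) s equitonal_trans same_pitch_lower_trans same_pitch_sym by blast+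
    then have "\<not> x \<prec> t'" using o unfolding is_octave_of_def by blast
    then show ?thesis using t lower_same_pitch_trans by blast
  qed
  ultimately show "is_octave_of s t" unfolding is_octave_of_def by blast
qed (auto simp: octave_interval_def)

text \<open>The octave intervals are one full congruence class: two octaves of the same sound are both minimal
  among its higher equitonal sounds, so they have the same pitch, and any octave interval can be
  transferred to any sound.\<close>

lemma octave_interval_cong_iff:
  assumes "octave_interval I" "J \<in> intervals"
  shows "octave_interval J \<longleftrightarrow> I \<cong> J"
proof
  obtain s t where I: "I = ivl s t" using assms(1) by (auto simp: octave_interval_def)
  obtain c d where J: "J = ivl c d" using assms(2) intervals_cases by blast
  show "octave_interval J" if "I \<cong> J"
    using that octave_cong[OF assms(1)] cong_sym unfolding I J by blast
  assume "octave_interval J"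
  then have d: "is_octave_of c d" unfolding J octave_interval_iff .
  obtain d' where d': "ivl_cong s t c d'" using cong_transfer by blast
  then have "octave_interval (ivl c d')" using octave_cong[OF assms(1)] cong_sym unfolding I by blast
  then have "is_octave_of c d'" unfolding octave_interval_iff .
  with d have "d' \<sim> d" unfolding is_octave_of_def same_pitch_def by blast
  then have "ivl c d' = ivl c d" by (simp add: ivl_eq_iff)
  with d' show "I \<cong> J" unfolding I J by simp
qed

theorem measure_exists: "\<exists>\<mu> \<in> intervals \<rightarrow>\<^sub>E {0<..}. is_measure \<mu>"
proof -
  interpret archimedean_ordered_group interval_group ascending
    by (rule interval_archimedean_ordered_group)
  obtain s t where o: "octave_interval (ivl s t)" using octave_exists octave_interval_def by metis
  then have "s \<prec> t" unfolding octave_interval_iff is_octave_of_def by blast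
  then have "interval_class s t \<in> ascending" by (simp add: interval_class_ascending)
  from additive_exists[OF this] obtain \<phi> :: "'a interval set \<Rightarrow> real" where
    add: "\<And>X Y. X \<in> carrier interval_group \<Longrightarrow> Y \<in> carrier interval_group
        \<Longrightarrow> \<phi> (X \<otimes>\<^bsub>interval_group\<^esub> Y) = \<phi> X + \<phi> Y"
    and pos: "\<And>X. X \<in> ascending \<Longrightarrow> \<phi> X > 0" and unit: "\<phi> (interval_class s t) = 1"
    by blast
  define \<mu> where "\<mu> = restrict (\<lambda>I. 2 powr \<phi> {J. I \<cong> J}) intervals"
  have \<mu>: "\<mu> (ivl a b) = 2 powr \<phi> (interval_class a b)" for a b
    by (simp add: \<mu>_def interval_class_def)
  have add': "\<phi> (interval_class a c) = \<phi> (interval_class a b) + \<phi> (interval_class b c)" for a b c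
    using add[of "interval_class a b" "interval_class b c"] by (simp add: interval_class_mult)
  have zero: "\<phi> (interval_class a b) = 0" if "a \<sim> b" for a b
  proof -
    have "interval_class a b = interval_class a a"
      using cong_same_pitchI[OF that, of a a] interval_class_eq_iff by simp
    then show ?thesis using add'[of a a a] by simp
  qed
  have up: "\<phi> (interval_class a b) > 0" if "a \<prec> b" for a b
    using pos that by (simp add: interval_class_ascending)
  have down: "\<phi> (interval_class a b) < 0" if "b \<prec> a" for a b
    using up[OF that] add'[of a a b] zero[of a a] by simp
  have sgn: "\<phi> (interval_class a b) > 0 \<longleftrightarrow> a \<prec> b" "\<phi> (interval_class a b) = 0 \<longleftrightarrow> a \<sim> b"
    "\<phi> (interval_class a b) < 0 \<longleftrightarrow> b \<prec> a" for a b
    using lower_cases[of a b] up[of a b] zero[of a b] down[of b a] by auto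
  have inj: "\<phi> (interval_class a b) = \<phi> (interval_class c d) \<longleftrightarrow> ivl_cong a b c d" for a b c d
  proof -
    obtain e where e: "ivl_cong a b c e" using cong_transfer by blast
    then have "\<phi> (interval_class a b) = \<phi> (interval_class c e)" using interval_class_eq_iff by metis
    then have "\<phi> (interval_class a b) = \<phi> (interval_class c d) \<longleftrightarrow> e \<sim> d"
      using add'[of c d e] sgn(2)[of e d] by simp
    also have "\<dots> \<longleftrightarrow> ivl_cong a b c d"
      using e cong_target_unique ivl_eq_iff same_pitch_refl by metis
    finally show ?thesis .
  qed
  have "is_measure \<mu>"
    unfolding is_measure_def
  proof (intro conjI allI impI)
    fix I assume I: "octave_interval I"
    then obtain a b where ab: "I = ivl a b" by (auto simp: octave_interval_def)
    then have "ivl_cong s t a b" using octave_interval_cong_iff[OF o, of I] I by simp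
    then have "interval_class a b = interval_class s t" using interval_class_eq_iff by metis
    then show "\<mu> I = 2" by (simp add: ab \<mu> unit)
  next
    fix a b c d
    show "\<mu> (ivl a b) > 1 \<longleftrightarrow> a \<prec> b" "\<mu> (ivl a b) = 1 \<longleftrightarrow> a \<sim> b" "\<mu> (ivl a b) < 1 \<longleftrightarrow> b \<prec> a"
      using sgn[of a b] powr_less_cancel_iff[of 2 0] powr_less_cancel_iff[of 2 _ 0] powr_inj[of 2 _ 0]
      by (simp_all add: \<mu>)
    show "\<mu> (ivl a b) = \<mu> (ivl c d) \<longleftrightarrow> ivl_cong a b c d"
      using inj by (simp add: \<mu> powr_inj)
    show "\<mu> (ivl a c) = \<mu> (ivl a b) * \<mu> (ivl b c)"
      unfolding \<mu> add'[of a c b] by (rule powr_add)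
  qed
  moreover have "\<mu> \<in> intervals \<rightarrow>\<^sub>E {0<..}" by (auto simp: \<mu>_def)
  ultimately show ?thesis by blast
qed

text \<open>The base 2 logarithm of a measure is an additive positive map on interval classes
  with value 1 on the octave.\<close>

theorem measure_unique:
  assumes \<mu>: "\<mu> \<in> intervals \<rightarrow>\<^sub>E {0<..}" "is_measure \<mu>"
    and \<nu>: "\<nu> \<in> intervals \<rightarrow>\<^sub>E {0<..}" "is_measure \<nu>"
  shows "\<mu> = \<nu>"
proof (rule PiE_ext[OF \<mu>(1) \<nu>(1)])
  fix I assume "I \<in> intervals"
  then obtain a b where I: "I = ivl a b" by (rule intervals_cases)
  interpret archimedean_ordered_group interval_group ascending
    by (rule interval_archimedean_ordered_group)
  obtain s t where o: "octave_interval (ivl s t)" using octave_exists octave_interval_def by metis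
  then have "s \<prec> t" unfolding octave_interval_iff is_octave_of_def by blast
  \<comment> \<open>The value of a measure on a class, read off from an arbitrary representative.\<close>
  define lg :: "('a interval \<Rightarrow> real) \<Rightarrow> 'a interval set \<Rightarrow> real"
    where "lg \<kappa> X = log 2 (\<kappa> (SOME J. J \<in> X))" for \<kappa> X
  have lg: "lg \<kappa> (interval_class a b) = log 2 (\<kappa> (ivl a b))"
    if "is_measure \<kappa>" for \<kappa> a b
  proof -
    have "(SOME J. J \<in> interval_class a b) \<in> interval_class a b"
      by (rule someI[of _ "ivl a b"]) (simp add: interval_class_def)
    then have c: "ivl a b \<cong> (SOME J. J \<in> interval_class a b)" by (simp add: interval_class_def)
    then obtain c d where "(SOME J. J \<in> interval_class a b) = ivl c d"
      using cong_on_intervals intervals_cases by metis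
    then show ?thesis using c that unfolding lg_def is_measure_def by metis
  qed
  have props: "(\<forall>X\<in>carrier interval_group. \<forall>Y\<in>carrier interval_group.
        lg \<kappa> (X \<otimes>\<^bsub>interval_group\<^esub> Y) = lg \<kappa> X + lg \<kappa> Y) \<and>
      (\<forall>X\<in>ascending. lg \<kappa> X > 0) \<and> lg \<kappa> (interval_class s t) = 1"
    if \<kappa>: "\<kappa> \<in> intervals \<rightarrow>\<^sub>E {0<..}" "is_measure \<kappa>" for \<kappa>
  proof (intro conjI ballI)
    fix X Y assume X: "X \<in> carrier interval_group" and Y: "Y \<in> carrier interval_group"
    obtain b where b: "X = interval_class undefined b" using interval_class_from X by blast
    obtain c where c: "Y = interval_class b c" using interval_class_from Y by blast
    have p: "\<kappa> (ivl x y) > 0" for x y using \<kappa>(1) PiE_mem[of \<kappa> intervals _ "ivl x y"] by fastforce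
    have "\<kappa> (ivl undefined c) = \<kappa> (ivl undefined b) * \<kappa> (ivl b c)"
      using \<kappa>(2) unfolding is_measure_def by blast
    then show "lg \<kappa> (X \<otimes>\<^bsub>interval_group\<^esub> Y) = lg \<kappa> X + lg \<kappa> Y"
      unfolding b c interval_class_mult lg[OF \<kappa>(2)]
      using p[of undefined b] p[of b c] by (simp add: log_mult)
  next
    fix X assume "X \<in> ascending"
    then obtain c d where "X = interval_class c d" "c \<prec> d" by (auto simp: ascending_def)
    moreover from this have "\<kappa> (ivl c d) > 1" using \<kappa>(2) unfolding is_measure_def by blast
    ultimately show "lg \<kappa> X > 0" using lg[OF \<kappa>(2)] by simp
  next
    have "\<kappa> (ivl s t) = 2" using \<kappa>(2) o unfolding is_measure_def by blast
    then show "lg \<kappa> (interval_class s t) = 1" using lg[OF \<kappa>(2)] by simp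
  qed
  have "lg \<mu> (interval_class a b) = lg \<nu> (interval_class a b)"
    by (rule additive_unique[where u = "interval_class s t"])
      (use props[OF \<mu>] props[OF \<nu>] \<open>s \<prec> t\<close> in \<open>auto simp: interval_class_ascending\<close>)
  moreover have "\<mu> (ivl a b) > 0" "\<nu> (ivl a b) > 0"
    using \<mu>(1) \<nu>(1) PiE_mem[of _ intervals _ "ivl a b"] by fastforce+
  ultimately show "\<mu> I = \<nu> I" unfolding I lg[OF \<mu>(2)] lg[OF \<nu>(2)]
    using inj_onD[OF log_inj[of 2]] by simp
qed

lemma measure_spec: "measure \<in> intervals \<rightarrow>\<^sub>E {0<..} \<and> is_measure measure"
proof -
  have "\<exists>!\<mu>. \<mu> \<in> intervals \<rightarrow>\<^sub>E {0<..} \<and> is_measure \<mu>"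
    using measure_exists measure_unique by blast
  then show ?thesis unfolding measure_def by (rule theI')
qed

lemma measure_pos: "I \<in> intervals \<Longrightarrow> measure I > 0"
  using measure_spec by fastforce

lemma measure_octave: "octave_interval I \<Longrightarrow> measure I = 2"
  and measure_gt_1_iff: "measure (ivl a b) > 1 \<longleftrightarrow> a \<prec> b"
  and measure_eq_1_iff: "measure (ivl a b) = 1 \<longleftrightarrow> a \<sim> b"
  and measure_lt_1_iff: "measure (ivl a b) < 1 \<longleftrightarrow> b \<prec> a"
  and measure_eq_iff: "measure (ivl a b) = measure (ivl c d) \<longleftrightarrow> ivl_cong a b c d"
  and measure_append: "measure (ivl a c) = measure (ivl a b) * measure (ivl b c)"
  using measure_spec unfolding is_measure_def by blast+

lemma measure_rev: "measure (ivl b a) = inverse (measure (ivl a b))"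
  using measure_append[of a a b] measure_eq_1_iff[of a a]
  by (metis inverse_unique same_pitch_refl)

lemma is_octave_of_iff_measure: "is_octave_of s t \<longleftrightarrow> measure (ivl s t) = 2"
proof -
  obtain a b where o: "octave_interval (ivl a b)" using octave_exists octave_interval_def by metis
  have "is_octave_of s t \<longleftrightarrow> ivl_cong a b s t"
    using octave_interval_cong_iff[OF o, of "ivl s t"] by (simp add: octave_interval_iff)
  then show ?thesis using measure_eq_iff[of a b s t] measure_octave[OF o] by auto
qed

text \<open>By minimality of the octave no sound strictly inside it is equitonal to its ends.\<close>

lemma tone_neq_within_octave:
  assumes "measure (ivl s t) = 2" and "s \<prec> x" and "x \<prec> t"
  shows "tone t = tone s" and "tone x \<noteq> tone s"
  using assms unfolding is_octave_of_iff_measure[symmetric] is_octave_of_def tone_eq_iff by blast+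

end

section \<open>Discrete multiplicative groups of positive reals\<close>

text \<open>The infimum \<open>e\<close> is attained: otherwise there would be elements \<open>s < r\<close> of the group in the open interval
  from \<open>e\<close> to \<open>e\<^sup>2\<close>, and \<open>r / s\<close> would be an element strictly between 1 and \<open>e\<close>. Dividing any element by
  the largest power of \<open>e\<close> below it leaves an element of \<open>[1, e)\<close>, which must be 1.\<close>

lemma discrete_multiplicative_group:
  fixes H :: "real set"
  assumes pos: "\<And>r. r \<in> H \<Longrightarrow> r > 0"
    and mult: "\<And>r s. r \<in> H \<Longrightarrow> s \<in> H \<Longrightarrow> r * s \<in> H"
    and inv: "\<And>r. r \<in> H \<Longrightarrow> inverse r \<in> H"
    and nontrivial: "\<exists>r\<in>H. r > 1"
    and gap: "\<alpha> > 1" "\<And>r. r \<in> H \<Longrightarrow> 1 < r \<Longrightarrow> \<alpha> \<le> r"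
  defines "e \<equiv> Inf {r \<in> H. r > 1}"
  shows "e > 1" and "H = range (\<lambda>k::int. e powi k)"
proof -
  let ?U = "{r \<in> H. r > 1}"
  have ne: "?U \<noteq> {}" using nontrivial by blast
  have bdd: "bdd_below ?U" by (rule bdd_belowI[of _ 1]) auto
  have "\<alpha> \<le> e" unfolding e_def by (rule cInf_greatest[OF ne]) (use gap in auto)
  then show e1: "e > 1" using gap by simp
  have lower: "e \<le> r" if "r \<in> H" "r > 1" for r
    unfolding e_def using that bdd by (intro cInf_lower) auto
  have quot: "r / s \<in> H" if "r \<in> H" "s \<in> H" for r s
    using mult[OF that(1) inv[OF that(2)]] by (simp add: field_simps)
  have eH: "e \<in> H"
  proof (rule ccontr)
    assume n: "e \<notin> H"
    have "e < e * e" using e1 by simp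
    then obtain r where r: "r \<in> H" "r > 1" "r < e * e"
      using cInf_lessD[OF ne, of "e * e"] unfolding e_def by auto
    have "e < r" using lower[OF r(1,2)] n r(1) by (cases "e = r") auto
    then obtain s where s: "s \<in> H" "s > 1" "s < r"
      using cInf_lessD[OF ne, of r] unfolding e_def by auto
    have "e \<le> r / s" using lower[of "r / s"] quot[OF r(1) s(1)] s by simp
    moreover have "e \<le> s" using lower s by blast
    ultimately have "e * e \<le> (r / s) * s" using e1 s by (intro mult_mono) auto
    then show False using r s by simp
  qed
  have nat: "e ^ Suc n \<in> H" for n by (induction n) (use eH mult in auto)
  have one: "1 \<in> H" using quot[OF eH eH] e1 by simp
  have powi: "e powi k \<in> H" for k
  proof -
    have n: "e ^ n \<in> H" for n using nat one by (cases n) auto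
    show ?thesis using n inv[OF n] by (cases k rule: int_cases2) (auto simp: power_int_minus)
  qed
  show "H = range (\<lambda>k::int. e powi k)"
  proof (intro equalityI subsetI)
    fix r assume r: "r \<in> H"
    define k where "k = \<lfloor>log e r\<rfloor>"
    have "e powr of_int k \<le> r" "r < e powr of_int (k + 1)"
      using pos[OF r] e1 powr_le_iff[of e r "of_int k"] less_powr_iff[of r e "of_int (k + 1)"]
        unfolding k_def by (simp_all add: le_log_iff[symmetric] log_less_iff[symmetric])
    then have k: "e powi k \<le> r" "r < e powi (k + 1)"
      using e1 powr_real_of_int'[of e k] powr_real_of_int'[of e "k + 1"] by auto
    have pk: "e powi k > 0" using e1 by simp
    have "r / e powi k \<in> H" using quot[OF r powi] .
    moreover have "r / e powi k < e" using k(2) pk e1 by (simp add: power_int_add field_simps)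
    ultimately have "\<not> r / e powi k > 1" using lower by fastforce
    then have "r = e powi k" using k(1) pk by (simp add: field_simps)
    then show "r \<in> range (\<lambda>k. e powi k)" by simp
  qed (use powi in auto)
qed

section \<open>The group of harmonic measures\<close>

context major_scale_harmony
begin

lemma harmonic_measures_cases:
  assumes "r \<in> harmonic_measures" obtains a b where "r = measure (ivl a b)" "ivl a b \<in> harmonic"
  using assms harmonic_subset intervals_cases unfolding harmonic_measures_def by blast

lemma harmonic_measures_from:
  assumes "r \<in> harmonic_measures" shows "\<exists>b. measure (ivl a b) = r"
proof -
  obtain c d where r: "r = measure (ivl c d)" using harmonic_measures_cases assms by blast
  obtain b where "ivl_cong c d a b" using cong_transfer by blast
  then show ?thesis using r measure_eq_iff by metis
qed

lemma harmonic_measures_pos: "r \<in> harmonic_measures \<Longrightarrow> r > 0"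
  using harmonic_subset measure_pos unfolding harmonic_measures_def by blast

lemma harmonic_measures_inverse:
  assumes "r \<in> harmonic_measures" shows "inverse r \<in> harmonic_measures"
proof -
  obtain a b where r: "r = measure (ivl a b)" "ivl a b \<in> harmonic" using harmonic_measures_cases assms by blast
  show ?thesis
  proof (cases "a \<sim> b")
    case True
    then have "r = 1" using r measure_eq_1_iff by simp
    then show ?thesis using assms by simp
  next
    case False
    then have "ivl b a \<in> harmonic" using harmonic_inverse r by blast
    then show ?thesis unfolding r measure_rev[of b a, symmetric] harmonic_measures_def by blast
  qed
qed

text \<open>The axiom has a factor above 1; the case of two factors below 1 follows by passing to
  inverses, as \<open>r * s\<close> is the inverse of \<open>inverse r * inverse s\<close>.\<close>

lemma harmonic_measures_mult:
  assumes r: "r \<in> harmonic_measures" and s: "s \<in> harmonic_measures" shows "r * s \<in> harmonic_measures"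
proof -
  consider "r = 1" | "s = 1" | "r > 1" "s \<noteq> 1" | "s > 1" "r \<noteq> 1" | "r < 1" "s < 1"
    by linarith
  then show ?thesis
  proof cases
    case 3 then show ?thesis using harmonic_mult r s by blast
  next
    case 4
    then have "s * r \<in> harmonic_measures" using harmonic_mult r s by blast
    then show ?thesis by (simp add: mult.commute)
  next
    case 5
    have "inverse r > 1" "inverse s > 1" using 5 r s harmonic_measures_pos by (simp_all add: one_less_inverse)
    then have "inverse r * inverse s \<in> harmonic_measures"
      using harmonic_mult[OF harmonic_measures_inverse[OF r] harmonic_measures_inverse[OF s]] by (simp del: inverse_eq_1_iff)
    from harmonic_measures_inverse[OF this] show ?thesis by simp
  qed (use r s in auto)
qed

lemma eps_gt_1: "\<epsilon> > 1" and harmonic_measures_eq_powers: "harmonic_measures = range (\<lambda>k::int. \<epsilon> powi k)"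
proof -
  obtain T rs rs' where s: "scale T rs rs'" "heptatonic rs rs'" using major_scale by blast
  then have "rs ! 0 \<in> harmonic_measures \<and> rs ! 0 > 1" unfolding scale_def heptatonic_def by (auto simp: all_set_conv_all_nth)
  then have n: "\<exists>r\<in>harmonic_measures. r > 1" by blast
  obtain \<alpha> where a: "\<alpha> > 1" "\<And>r. r \<in> harmonic_measures \<Longrightarrow> 1 < r \<Longrightarrow> \<alpha> \<le> r"
    using harmonic_gap linorder_not_less by metis
  note * = discrete_multiplicative_group[OF harmonic_measures_pos harmonic_measures_mult harmonic_measures_inverse n a, folded eps_def]
  show "\<epsilon> > 1" using * by blast
  show "harmonic_measures = range (\<lambda>k::int. \<epsilon> powi k)" using * by blast
qed

lemma steps_exist:
  assumes "set rs \<subseteq> harmonic_measures"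
  shows "\<exists>\<sigma>. \<sigma> 0 = s \<and> steps rs \<sigma>"
proof -
  define \<sigma> where "\<sigma> = rec_nat s (\<lambda>i x. SOME y. measure (ivl x y) = rs ! i)"
  have "measure (ivl (\<sigma> i) (\<sigma> (Suc i))) = rs ! i" if "i < length rs" for i
  proof -
    have "\<exists>y. measure (ivl (\<sigma> i) y) = rs ! i" using harmonic_measures_from assms that nth_mem by blast
    from someI_ex[OF this] show ?thesis by (simp add: \<sigma>_def)
  qed
  moreover have "\<sigma> 0 = s" by (simp add: \<sigma>_def)
  ultimately show ?thesis unfolding steps_def by blast
qed

lemma measure_steps:
  assumes "steps rs \<sigma>" "n \<le> length rs"
  shows "measure (ivl (\<sigma> 0) (\<sigma> n)) = prod_list (take n rs)"
  using assms(2)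
proof (induction n)
  case 0
  then show ?case by (simp add: measure_eq_1_iff)
next
  case (Suc n)
  then have "measure (ivl (\<sigma> n) (\<sigma> (Suc n))) = rs ! n" using assms(1) by (simp add: steps_def)
  with Suc show ?case
    using measure_append[of "\<sigma> 0" "\<sigma> (Suc n)" "\<sigma> n"] by (simp add: take_Suc_conv_app_nth)
qed

end

section \<open>Tetrachords and the pattern of the major scale\<close>

lemma prod_list_gt_1:
  fixes xs :: "real list"
  assumes "xs \<noteq> []" "\<forall>x\<in>set xs. x > 1" shows "prod_list xs > 1"
  using assms by (induction xs rule: list_nonempty_induct) (auto intro: less_1_mult)

lemma prod_list_lt_1:
  fixes xs :: "real list"
  assumes "xs \<noteq> []" "\<forall>x\<in>set xs. 0 < x \<and> x < 1" shows "0 < prod_list xs \<and> prod_list xs < 1"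
  using assms
proof (induction xs rule: list_nonempty_induct)
  case (cons x xs)
  then have "x * prod_list xs < 1 * 1" by (intro mult_strict_mono) auto
  with cons show ?case by simp
qed auto

context major_scale_harmony
begin

text \<open>Ascendent and descendent modules are treated alike: a module fills the octave above or below its
  first sound.\<close>

definition octave_module :: "real list \<Rightarrow> bool" where
  "octave_module rs \<longleftrightarrow> set rs \<subseteq> harmonic_measures \<and>
    ((\<forall>r\<in>set rs. r > 1) \<and> prod_list rs = 2 \<or> (\<forall>r\<in>set rs. r < 1) \<and> prod_list rs = 1 / 2)"

text \<open>A realisation of the module on actual sounds runs monotonically through one octave, so its inner
  sounds lie strictly between two successive sounds of the tonic. The chosen tone \<open>X\<close> is the same
  for every \<open>J\<close>: it will serve as a common component of two tetrachords.\<close>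

lemma inner_component_neq_tonic:
  assumes T: "T \<in> range tone" and rs: "octave_module rs" and j: "0 < j" "j < length rs"
  shows "\<exists>X. X \<noteq> T \<and> (\<forall>J. j \<in> J \<longrightarrow> X \<in> components T rs J)"
proof -
  obtain s where s: "T = tone s" using T by blast
  obtain \<sigma> where \<sigma>: "\<sigma> 0 = s" "steps rs \<sigma>" using steps_exist rs unfolding octave_module_def by blast
  let ?n = "length rs"
  have m: "measure (ivl (\<sigma> 0) (\<sigma> j)) = prod_list (take j rs)"
    using measure_steps[OF \<sigma>(2), of j] j by simp
  have n: "measure (ivl (\<sigma> 0) (\<sigma> ?n)) = prod_list rs"
    using measure_steps[OF \<sigma>(2), of ?n] by simp
  have split: "prod_list rs = prod_list (take j rs) * prod_list (drop j rs)"
    using prod_list.append[of "take j rs" "drop j rs"] by simp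
  have "measure (ivl (\<sigma> 0) (\<sigma> j)) > 0" by (rule measure_pos) simp
  then have r: "measure (ivl (\<sigma> j) (\<sigma> ?n)) = prod_list (drop j rs)"
    using measure_append[of "\<sigma> 0" "\<sigma> ?n" "\<sigma> j"] unfolding m n split by simp
  have ne: "take j rs \<noteq> []" "drop j rs \<noteq> []" using j by auto
  have sub: "set (take j rs) \<subseteq> set rs" "set (drop j rs) \<subseteq> set rs"
    by (rule set_take_subset, rule set_drop_subset)
  have "tone (\<sigma> j) \<noteq> tone (\<sigma> 0)"
    using rs unfolding octave_module_def
  proof (elim conjE disjE)
    assume *: "\<forall>r\<in>set rs. r > 1" "prod_list rs = 2"
    have "prod_list (take j rs) > 1" "prod_list (drop j rs) > 1"
      using prod_list_gt_1[OF ne(1)] prod_list_gt_1[OF ne(2)] *(1) sub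
      by (auto simp: subset_iff)
    then have "\<sigma> 0 \<prec> \<sigma> j" "\<sigma> j \<prec> \<sigma> ?n" using m r measure_gt_1_iff[of "\<sigma> 0" "\<sigma> j"] measure_gt_1_iff[of "\<sigma> j" "\<sigma> ?n"] by simp_all
    then show ?thesis using tone_neq_within_octave(2)[of "\<sigma> 0" "\<sigma> ?n" "\<sigma> j"] n *(2) by simp
  next
    assume *: "set rs \<subseteq> harmonic_measures" "\<forall>r\<in>set rs. r < 1" "prod_list rs = 1 / 2"
    have "prod_list (take j rs) < 1" "prod_list (drop j rs) < 1"
      using prod_list_lt_1[OF ne(1)] prod_list_lt_1[OF ne(2)] *(1,2) sub harmonic_measures_pos
      by (auto simp: subset_iff)
    then have "\<sigma> j \<prec> \<sigma> 0" "\<sigma> ?n \<prec> \<sigma> j" using m r measure_lt_1_iff[of "\<sigma> 0" "\<sigma> j"] measure_lt_1_iff[of "\<sigma> j" "\<sigma> ?n"] by simp_all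
    have "measure (ivl (\<sigma> ?n) (\<sigma> 0)) = inverse (1 / 2)"
      unfolding *(3)[symmetric] n[symmetric] by (rule measure_rev)
    then have "measure (ivl (\<sigma> ?n) (\<sigma> 0)) = 2" by simp
    from tone_neq_within_octave[OF this \<open>\<sigma> ?n \<prec> \<sigma> j\<close> \<open>\<sigma> j \<prec> \<sigma> 0\<close>]
    show ?thesis by metis
  qed
  then have "tone (\<sigma> j) \<noteq> T" by (simp add: s \<sigma>(1))
  moreover have "\<sigma> 0 \<in> T" unfolding s \<sigma>(1) tone_def using equitonal_if_same_pitch[of s s] by simp
  then have "tone (\<sigma> j) \<in> components T rs J" if "j \<in> J" for J
    unfolding components_def using \<sigma>(2) that by blast
  ultimately show ?thesis by blast
qed

text \<open>Tetrachords starting at positions \<open>k\<close> and \<open>l\<close> share an inner component unless \<open>{k, l} = {0, 4}\<close>: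
  if \<open>k \<le> l \<le> k + 3\<close>, the component number \<open>max 1 l\<close> belongs to both and is neither the
  first nor the last one. This covers a tetrachord paired with itself as well.\<close>

lemma disjoint_equal_tetrachords_in_module:
  assumes T: "T \<in> range tone" and rs: "octave_module rs" and len: "length rs = 7"
    and t: "(t, C) \<in> module_tetrachords T rs" "(t, C') \<in> module_tetrachords T rs"
    and disj: "C \<inter> C' \<subseteq> {T}"
  shows "rs ! 0 = rs ! 4 \<and> rs ! 1 = rs ! 5 \<and> rs ! 2 = rs ! 6"
proof -
  obtain k where k: "t = (rs ! k, rs ! (k + 1), rs ! (k + 2))" "C = components T rs {k..k + 3}" "k \<le> 4"
    using t(1) len unfolding module_tetrachords_def by auto
  obtain l where l: "t = (rs ! l, rs ! (l + 1), rs ! (l + 2))" "C' = components T rs {l..l + 3}" "l \<le> 4"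
    using t(2) len unfolding module_tetrachords_def by auto
  have "\<not> (0 < j \<and> j < 7 \<and> j \<in> {k..k + 3} \<and> j \<in> {l..l + 3})" for j
  proof
    assume j: "0 < j \<and> j < 7 \<and> j \<in> {k..k + 3} \<and> j \<in> {l..l + 3}"
    then obtain X where "X \<noteq> T" "\<And>J. j \<in> J \<Longrightarrow> X \<in> components T rs J"
      using inner_component_neq_tonic[OF T rs, of j] len by auto
    then show False using j disj unfolding k(2) l(2) by blast
  qed
  from this[of "max 1 (max k l)"] have "k = 0 \<and> l = 4 \<or> k = 4 \<and> l = 0"
    using k(3) l(3) by auto
  then show ?thesis using k(1) l(1) by (auto simp: numeral_2_eq_2)
qed

text \<open>Equal tetrachords belong to the same module, since ascendent steps exceed 1 and descendent
  steps do not. By compatibility the descendent module is the ascendent one reversed and inverted, so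
  both modules lead to the same equations.\<close>

theorem major_scale_pattern:
  assumes "scale T rs rs'" "heptatonic rs rs'" "compatible rs rs'"
    and "has_disjoint_equal_tetrachords T rs rs'"
  shows "rs ! 0 = rs ! 4 \<and> rs ! 1 = rs ! 5 \<and> rs ! 2 = rs ! 6"
proof -
  have T: "T \<in> range tone" and up: "octave_module rs" "\<forall>r\<in>set rs. r > 1"
    and down: "octave_module rs'" "\<forall>r\<in>set rs'. r < 1"
    using assms(1) unfolding scale_def octave_module_def by auto
  have len: "length rs = 7" "length rs' = 7" using assms(2) by (simp_all add: heptatonic_def)
  obtain t C C' where t: "(t, C) \<in> tetrachords T rs rs'" "(t, C') \<in> tetrachords T rs rs'" "C \<inter> C' \<subseteq> {T}"
    using assms(4) unfolding has_disjoint_equal_tetrachords_def by blast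
  have fst_in: "fst t \<in> set qs" if "(t, D) \<in> module_tetrachords T qs" for D qs
    using that unfolding module_tetrachords_def by auto
  have no_mix: "\<not> ((t, D) \<in> module_tetrachords T rs \<and> (t, D') \<in> module_tetrachords T rs')" for D D'
    using fst_in[of D rs] fst_in[of D' rs'] up(2) down(2) less_asym[of "fst t" 1] by blast
  consider "(t, C) \<in> module_tetrachords T rs" "(t, C') \<in> module_tetrachords T rs"
    | "(t, C) \<in> module_tetrachords T rs'" "(t, C') \<in> module_tetrachords T rs'"
    using t no_mix unfolding tetrachords_def by blast
  then show ?thesis
  proof cases
    case 1
    then show ?thesis using disjoint_equal_tetrachords_in_module[OF T up(1) len(1) _ _ t(3)] by blast
  next
    case 2
    then have "rs' ! 0 = rs' ! 4 \<and> rs' ! 1 = rs' ! 5 \<and> rs' ! 2 = rs' ! 6"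
      using disjoint_equal_tetrachords_in_module[OF T down(1) len(2) _ _ t(3)] by blast
    moreover have "rs' ! i = inverse (rs ! (6 - i))" if "i < 7" for i
      using assms(3) len that unfolding compatible_def by simp
    ultimately show ?thesis by simp
  qed
qed

section \<open>Twelve equal steps\<close>

lemma eps_power_inject: "\<epsilon> powi i = \<epsilon> powi j \<longleftrightarrow> i = j"
  using eps_gt_1 power_int_strict_increasing[of i j \<epsilon>] power_int_strict_increasing[of j i \<epsilon>]
  by (cases i j rule: linorder_cases) auto

text \<open>With \<open>p\<close> the measure of the upper interval, the lower one has measure \<open>\<epsilon> p\<close>, so
  \<open>\<epsilon> p\<^sup>2 = \<epsilon> 2\<^bsup>1/2\<^esup>\<close>, and \<open>p\<close> is a power of \<open>\<epsilon>\<close>.\<close>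

lemma major_triad_fourth_root:
  assumes "major_triad x y z"
  shows "\<exists>j. \<epsilon> powi (4 * j) = 2"
proof -
  let ?p = "measure (ivl y z)"
  have "?p \<in> harmonic_measures" using assms unfolding major_triad_def triad_def harmonic_measures_def by blast
  then obtain j where j: "?p = \<epsilon> powi j" using harmonic_measures_eq_powers by blast
  have xz: "\<epsilon> * 2 powr (1 / 2) = measure (ivl x z)" and xy: "measure (ivl x y) = \<epsilon> * ?p"
    using assms unfolding major_triad_def by simp_all
  have "\<epsilon> * 2 powr (1 / 2) = \<epsilon> * (?p * ?p)"
    unfolding xz measure_append[of x z y] xy by (rule mult.assoc)
  then have "?p * ?p = 2 powr (1 / 2)" using eps_gt_1 by simp
  then have "(?p * ?p) * (?p * ?p) = 2 powr (1 / 2) * 2 powr (1 / 2)" by simp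
  also have "\<dots> = 2" by (simp add: powr_add[symmetric])
  finally have "?p ^ 4 = 2" by (simp add: power4_eq_xxxx mult.assoc)
  then have "\<epsilon> powi (j * 4) = 2" using power_int_mult[of \<epsilon> j 4] by (simp add: j)
  then show ?thesis by (metis mult.commute)
qed

text \<open>As \<open>\<epsilon>\<close> is itself a step, the exponents of the mode are 0 and 1 or 1 and 2. The first pair would
  force every step to be \<open>\<epsilon>\<close>, because steps exceed 1; but the first step is the inverse of the last
  descendent one, which differs from \<open>\<epsilon>\<close> when the descendent module lacks the sensible.\<close>

lemma major_scale_steps:
  assumes sc: "scale T rs rs'" and "heptatonic rs rs'" "compatible rs rs'"
    and even: "maximally_even (set rs)" and up: "ascendent_sensible rs" and down: "\<not> descendent_sensible rs'"
  shows "rs ! 0 = \<epsilon> ^ 2" and "rs ! 6 = \<epsilon>" and "\<And>i. i < 7 \<Longrightarrow> \<exists>a\<in>{1, 2::nat}. rs ! i = \<epsilon> ^ a"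
proof -
  have len: "length rs = 7" "length rs' = 7" using assms(2) by (simp_all add: heptatonic_def)
  then have ne: "rs \<noteq> []" "rs' \<noteq> []" by auto
  show last: "rs ! 6 = \<epsilon>" using up len ne by (simp add: ascendent_sensible_def last_conv_nth)
  have "inverse (last rs') = rs ! 0"
    using assms(3) len ne unfolding compatible_def by (simp add: last_conv_nth)
  then have first: "rs ! 0 \<noteq> \<epsilon>" using down by (simp add: descendent_sensible_def)
  obtain k where k: "set rs \<subseteq> {\<epsilon> powi k, \<epsilon> powi (k + 1)}" using even unfolding maximally_even_def by blast
  have mem: "rs ! i \<in> set rs" if "i < 7" for i using that len by simp
  have "\<epsilon> \<in> {\<epsilon> powi k, \<epsilon> powi (k + 1)}" using k mem[of 6] last by auto
  then have "k = 1 \<or> k = 0" using eps_power_inject[of 1 k] eps_power_inject[of 1 "k + 1"] by auto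
  moreover have "k \<noteq> 0"
  proof
    assume "k = 0"
    then have "rs ! 0 = 1" using k mem[of 0] first by auto
    moreover have "rs ! 0 > 1" using sc mem[of 0] unfolding scale_def by auto
    ultimately show False by simp
  qed
  ultimately have in12: "rs ! i \<in> {\<epsilon> ^ 1, \<epsilon> ^ 2}" if "i < 7" for i using k mem[OF that] by auto
  then show "\<exists>a\<in>{1, 2::nat}. rs ! i = \<epsilon> ^ a" if "i < 7" for i using that by blast
  show "rs ! 0 = \<epsilon> ^ 2" using in12[of 0] first by auto
qed

theorem eps_eq: "\<epsilon> = 2 powr (1 / 12)"
proof -
  obtain T rs rs' x y z where sc: "scale T rs rs'" "heptatonic rs rs'" "compatible rs rs'"
      "maximally_even (set rs)" "ascendent_sensible rs" "\<not> descendent_sensible rs'"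
      "has_disjoint_equal_tetrachords T rs rs'" "major_triad x y z"
    using major_scale by blast
  note pattern = major_scale_pattern[OF sc(1-3,7)] and steps = major_scale_steps[OF sc(1-6)]
  have "(1::nat) < 7" "(3::nat) < 7" by simp_all
  note inner = this[THEN steps(3)]
  obtain a where a: "a \<in> {1, 2::nat}" "rs ! 1 = \<epsilon> ^ a" using inner(1) by blast
  obtain b where b: "b \<in> {1, 2::nat}" "rs ! 3 = \<epsilon> ^ b" using inner(2) by blast
  \<comment> \<open>The exponents along the scale are 2, a, 1, b, 2, a, 1.\<close>
  define N where "N = 6 + 2 * a + b"
  have "prod_list rs = prod_list (map ((!) rs) [0..<7])"
    using sc(2) map_nth[of rs] unfolding heptatonic_def by metis
  also have "\<dots> = rs ! 0 * rs ! 1 * rs ! 2 * rs ! 3 * rs ! 4 * rs ! 5 * rs ! 6"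
    by (simp add: upt_rec mult.assoc eval_nat_numeral)
  also have "\<dots> = \<epsilon> ^ N"
    using pattern steps(1,2) a(2) b(2) by (simp add: N_def power_add power_mult power2_eq_square eval_nat_numeral algebra_simps)
  finally have N: "\<epsilon> ^ N = 2" using sc(1) by (simp add: scale_def)
  obtain j where "\<epsilon> powi (4 * j) = 2" using major_triad_fourth_root[OF sc(8)] by blast
  then have "\<epsilon> powi (4 * j) = \<epsilon> powi (int N)" using N by simp
  then have "4 * j = int N" using eps_power_inject by blast
  then have "4 dvd N" by presburger
  moreover have "N \<in> {9, 10, 11, 12}" using a(1) b(1) by (auto simp: N_def)
  ultimately have "N = 12" by auto
  then have "\<epsilon> powr 12 = 2" using N eps_gt_1 powr_realpow[of \<epsilon> 12] by simp
  then have "2 powr (1 / 12) = (\<epsilon> powr 12) powr (1 / 12)" by simp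
  also have "\<dots> = \<epsilon>" unfolding powr_powr using eps_gt_1 by simp
  finally show ?thesis by simp
qed

theorem harmonic_measures_eq: "harmonic_measures = {2 powr (real_of_int n / 12) | n :: int. True}"
proof -
  have "\<epsilon> powi n = 2 powr (real_of_int n / 12)" for n :: int
  proof -
    have "\<epsilon> powi n = \<epsilon> powr real_of_int n" using eps_gt_1 by (simp add: powr_real_of_int')
    then show ?thesis by (simp add: eps_eq powr_powr)
  qed
  then show ?thesis using harmonic_measures_eq_powers by auto
qed

end

theorem corollary5p82:
  fixes lower :: "'a \<Rightarrow> 'a \<Rightarrow> bool"
    and cong :: "'a interval \<Rightarrow> 'a interval \<Rightarrow> bool"
    and equitonal :: "'a \<Rightarrow> 'a \<Rightarrow> bool"
    and harmonic :: "'a interval set"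
  assumes "major_scale_harmony lower cong equitonal harmonic"
  shows "harmonic_intervals.harmonic_measures lower cong equitonal harmonic
    = {2 powr (real_of_int n / 12) | n :: int. True}"
  by (rule major_scale_harmony.harmonic_measures_eq[OF assms])

end
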